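(* For $n\ge2$ the group $Cb_n$ of basis-conjugating automorphisms has no proper verbal subgroups of finite width; that is, for every finite proper set of words $V$ the width $\mathrm{wid}(Cb_n,V)$ is infinite.
   Context: $F_n$ is the free group on $x_1,\dots,x_n$. $Cb_n\le\mathrm{Aut}(F_n)$ is the group of basis-conjugating automorphisms, those sending each $x_i$ to $f_i^{-1}x_if_i$ for some $f_i\in F_n$. Let $V$ be a set of group words in an alphabet of variables. For a group $G$, a value of a word in $G$ is an element obtained by substituting elements of $G$ for the variables. The verbal subgroup $V(G)$ is the subgroup of $G$ generated by all values in $G$ of words from $V^{\pm1}$. The width $\mathrm{wid}(G,V)$ is the minimal $m\in\mathbb{N}\cup\{+\infty\}$ such that every element of $V(G)$ is a product of at most $m$ values of words from $V^{\pm1}$. A subgroup is proper if it is nontrivial and not the whole group. $V$ is a proper set of words if $V(F_2)$ is a proper subgroup of the free group $F_2$ of rank 2. A group $G$ "has no proper verbal subgroups of finite width" if $\mathrm{wid}(G,V)$ is infinite for each finite proper set of words $V$. *)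

theory Defs
  imports "HOL-Algebra.Bij" "HOL-Algebra.Generated_Groups" "HOL-Library.Extended_Nat"
begin

section \<open>Group words\<close>

text \<open>The letter \<open>(x, True)\<close> stands for \<open>x\<close> and \<open>(x, False)\<close> for its inverse.
  Words are not assumed to be reduced.\<close>

type_synonym 'v letter = "'v \<times> bool"
type_synonym 'v word = "'v letter list"

definition inv_letter :: "'v letter \<Rightarrow> 'v letter" where
  "inv_letter l = (fst l, \<not> snd l)"

definition inv_word :: "'v word \<Rightarrow> 'v word" where
  "inv_word w = rev (map inv_letter w)"

definition letter_value :: "('g, 'm) monoid_scheme \<Rightarrow> ('v \<Rightarrow> 'g) \<Rightarrow> 'v letter \<Rightarrow> 'g" where
  "letter_value G \<sigma> l = (if snd l then \<sigma> (fst l) else inv\<^bsub>G\<^esub> (\<sigma> (fst l)))"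

definition word_value :: "('g, 'm) monoid_scheme \<Rightarrow> ('v \<Rightarrow> 'g) \<Rightarrow> 'v word \<Rightarrow> 'g" where
  "word_value G \<sigma> w = foldr (\<lambda>l g. letter_value G \<sigma> l \<otimes>\<^bsub>G\<^esub> g) w \<one>\<^bsub>G\<^esub>"


section \<open>Free groups\<close>

definition reduced :: "'v word \<Rightarrow> bool" where
  "reduced w \<longleftrightarrow> successively (\<lambda>l m. m \<noteq> inv_letter l) w"

fun push_letter :: "'v letter \<Rightarrow> 'v word \<Rightarrow> 'v word" where
  "push_letter l [] = [l]"
| "push_letter l (m # w) = (if m = inv_letter l then w else l # m # w)"

definition reduce_word :: "'v word \<Rightarrow> 'v word" where
  "reduce_word w = foldr push_letter w []"

definition free_group :: "'v set \<Rightarrow> 'v word monoid" where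
  "free_group S =
     \<lparr>carrier = {w. reduced w \<and> fst ` set w \<subseteq> S},
      mult = (\<lambda>u v. reduce_word (u @ v)),
      one = []\<rparr>"

definition free_gen :: "'v \<Rightarrow> 'v word" where
  "free_gen x = [(x, True)]"

definition Fn :: "nat \<Rightarrow> nat word monoid" where
  "Fn n = free_group {1..n}"

lemma inv_letter_inv_letter [simp]: "inv_letter (inv_letter l) = l"
  by (simp add: inv_letter_def)

lemma fst_inv_letter [simp]: "fst (inv_letter l) = fst l"
  by (simp add: inv_letter_def)

lemma reduced_simps [simp]:
  "reduced []" "reduced [l]"
  "reduced (l # m # w) \<longleftrightarrow> m \<noteq> inv_letter l \<and> reduced (m # w)"
  by (simp_all add: reduced_def)

lemma reduced_ConsD: "reduced (l # w) \<Longrightarrow> reduced w"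
  by (cases w) auto

lemma reduced_push_letter: "reduced w \<Longrightarrow> reduced (push_letter l w)"
  by (cases w) (auto dest: reduced_ConsD)

lemma reduced_foldr_push: "reduced w \<Longrightarrow> reduced (foldr push_letter u w)"
  by (induction u) (auto intro: reduced_push_letter)

lemma reduced_reduce_word [simp]: "reduced (reduce_word w)"
  by (simp add: reduce_word_def reduced_foldr_push)

lemma reduce_word_reduced: "reduced w \<Longrightarrow> reduce_word w = w"
proof (induction w)
  case (Cons l w)
  then have "reduce_word w = w" by (auto dest: reduced_ConsD)
  with Cons.prems show ?case
    by (cases w) (auto simp: reduce_word_def)
qed (simp add: reduce_word_def)

lemma push_letter_cancel: "reduced w \<Longrightarrow> push_letter l (push_letter (inv_letter l) w) = w"
  by (cases w; cases "tl w") auto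

lemma foldr_push_reduce:
  assumes "reduced w"
  shows "foldr push_letter (reduce_word u) w = foldr push_letter u w"
proof (induction u)
  case (Cons l u)
  have "foldr push_letter (push_letter l r) w = push_letter l (foldr push_letter r w)" for r
  proof (cases r)
    case (Cons m r')
    then show ?thesis
      using push_letter_cancel[OF reduced_foldr_push[OF assms], of l r'] by auto
  qed simp
  with Cons show ?case by (simp add: reduce_word_def)
qed (simp add: reduce_word_def)

lemma fst_set_reduce_word: "fst ` set (reduce_word w) \<subseteq> fst ` set w"
proof (induction w)
  case (Cons l w)
  have "set (push_letter l r) \<subseteq> insert l (set r)" for r
    by (cases r) auto
  with Cons show ?case by (force simp: reduce_word_def)
qed (simp add: reduce_word_def)

lemma reduce_inv_word: "foldr push_letter (inv_word w) w = []"
  by (induction w) (simp_all add: inv_word_def)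

lemma reduce_word_append: "reduce_word (u @ v) = foldr push_letter u (reduce_word v)"
  by (simp add: reduce_word_def)

lemma group_free_group: "group (free_group S)"
proof (rule groupI)
  fix u v assume "u \<in> carrier (free_group S)" "v \<in> carrier (free_group S)"
  then show "u \<otimes>\<^bsub>free_group S\<^esub> v \<in> carrier (free_group S)"
    using order_trans[OF fst_set_reduce_word[of "u @ v"]] by (simp add: free_group_def image_Un)
next
  show "\<one>\<^bsub>free_group S\<^esub> \<in> carrier (free_group S)"
    by (simp add: free_group_def)
next
  fix u v w
  show "u \<otimes>\<^bsub>free_group S\<^esub> v \<otimes>\<^bsub>free_group S\<^esub> w = u \<otimes>\<^bsub>free_group S\<^esub> (v \<otimes>\<^bsub>free_group S\<^esub> w)"
    using foldr_push_reduce[of "reduce_word w" "u @ v"]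
    by (simp add: free_group_def reduce_word_append reduce_word_reduced reduced_foldr_push)
next
  fix w assume "w \<in> carrier (free_group S)"
  then show "\<one>\<^bsub>free_group S\<^esub> \<otimes>\<^bsub>free_group S\<^esub> w = w"
    by (simp add: free_group_def reduce_word_reduced)
next
  fix w assume w: "w \<in> carrier (free_group S)"
  let ?v = "reduce_word (inv_word w)"
  have "fst ` set (inv_word w) = fst ` set w"
    by (force simp: inv_word_def image_iff)
  then have "?v \<in> carrier (free_group S)"
    using w order_trans[OF fst_set_reduce_word[of "inv_word w"]] by (simp add: free_group_def)
  moreover have "?v \<otimes>\<^bsub>free_group S\<^esub> w = \<one>\<^bsub>free_group S\<^esub>"
    using w by (simp add: free_group_def reduce_word_append reduce_word_reduced
        foldr_push_reduce reduce_inv_word)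
  ultimately show "\<exists>v\<in>carrier (free_group S). v \<otimes>\<^bsub>free_group S\<^esub> w = \<one>\<^bsub>free_group S\<^esub>" ..
qed


section \<open>Basis-conjugating automorphisms\<close>

text \<open>The multiplication is inherited from \<^const>\<open>AutoGroup\<close>: the product of \<open>\<phi>\<close> and \<open>\<psi>\<close> is
  \<open>\<phi> \<circ> \<psi>\<close>. The opposite convention gives the opposite group, isomorphic by inversion.\<close>

definition basis_conj_auto :: "nat \<Rightarrow> (nat word \<Rightarrow> nat word) set" where
  "basis_conj_auto n =
     {\<phi> \<in> auto (Fn n). \<forall>i\<in>{1..n}. \<exists>f\<in>carrier (Fn n).
        \<phi> (free_gen i) = inv\<^bsub>Fn n\<^esub> f \<otimes>\<^bsub>Fn n\<^esub> free_gen i \<otimes>\<^bsub>Fn n\<^esub> f}"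

definition Cb :: "nat \<Rightarrow> (nat word \<Rightarrow> nat word) monoid" where
  "Cb n = AutoGroup (Fn n)\<lparr>carrier := basis_conj_auto n\<rparr>"

lemma subgroup_basis_conj_auto: "subgroup (basis_conj_auto n) (AutoGroup (Fn n))"
proof -
  interpret G: group "Fn n" unfolding Fn_def by (rule group_free_group)
  interpret A: group "AutoGroup (Fn n)" by (rule G.AutoGroup)
  let ?S = "carrier (Fn n)"
  have gen: "free_gen i \<in> ?S" if "i \<in> {1..n}" for i
    using that by (simp add: Fn_def free_group_def free_gen_def)
  have hom: "group_hom (Fn n) (Fn n) \<phi>" if "\<phi> \<in> auto (Fn n)" for \<phi>
    using that by unfold_locales (auto simp: auto_def)
  have auto_mult: "\<phi> \<otimes>\<^bsub>AutoGroup (Fn n)\<^esub> \<psi> = compose ?S \<phi> \<psi>"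
    if "\<phi> \<in> auto (Fn n)" "\<psi> \<in> auto (Fn n)" for \<phi> \<psi>
    using that by (simp add: AutoGroup_def BijGroup_def auto_def)
  have carr: "carrier (AutoGroup (Fn n)) = auto (Fn n)"
    and one: "\<one>\<^bsub>AutoGroup (Fn n)\<^esub> = (\<lambda>x\<in>?S. x)"
    by (simp_all add: AutoGroup_def BijGroup_def)
  show ?thesis
  proof (rule A.subgroupI)
    show "basis_conj_auto n \<subseteq> carrier (AutoGroup (Fn n))"
      unfolding carr by (auto simp: basis_conj_auto_def)
    have "\<one>\<^bsub>AutoGroup (Fn n)\<^esub> \<in> basis_conj_auto n"
      using gen G.id_in_auto by (auto simp: basis_conj_auto_def one intro!: bexI[of _ "\<one>\<^bsub>Fn n\<^esub>"])
    then show "basis_conj_auto n \<noteq> {}" by blast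
  next
    fix \<phi> assume \<phi>: "\<phi> \<in> basis_conj_auto n"
    define \<psi> where "\<psi> = inv\<^bsub>AutoGroup (Fn n)\<^esub> \<phi>"
    have \<phi>a: "\<phi> \<in> auto (Fn n)" using \<phi> by (simp add: basis_conj_auto_def)
    then have \<psi>a: "\<psi> \<in> auto (Fn n)" using A.inv_closed[of \<phi>] by (simp add: \<psi>_def carr)
    interpret p: group_hom "Fn n" "Fn n" \<psi> by (rule hom[OF \<psi>a])
    interpret f: group_hom "Fn n" "Fn n" \<phi> by (rule hom[OF \<phi>a])
    have "compose ?S \<psi> \<phi> = (\<lambda>x\<in>?S. x)"
      using A.l_inv[of \<phi>] \<phi>a \<psi>a by (simp add: \<psi>_def[symmetric] auto_mult carr one)
    then have eq: "\<psi> (\<phi> x) = x" if "x \<in> ?S" for x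
      using that by (simp add: fun_eq_iff compose_def) metis
    have "\<exists>g\<in>?S. \<psi> (free_gen i) = inv\<^bsub>Fn n\<^esub> g \<otimes>\<^bsub>Fn n\<^esub> free_gen i \<otimes>\<^bsub>Fn n\<^esub> g" if i: "i \<in> {1..n}" for i
    proof -
      from \<phi> i obtain f where f: "f \<in> ?S"
        and fi: "\<phi> (free_gen i) = inv\<^bsub>Fn n\<^esub> f \<otimes>\<^bsub>Fn n\<^esub> free_gen i \<otimes>\<^bsub>Fn n\<^esub> f"
        unfolding basis_conj_auto_def by blast
      have dec: "inv\<^bsub>Fn n\<^esub> (\<psi> f) \<otimes>\<^bsub>Fn n\<^esub> \<psi> (free_gen i) \<otimes>\<^bsub>Fn n\<^esub> \<psi> f = free_gen i"
        using eq[OF gen[OF i]] f gen[OF i] by (simp add: fi)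
      have cancel: "inv\<^bsub>Fn n\<^esub> (inv\<^bsub>Fn n\<^esub> a) \<otimes>\<^bsub>Fn n\<^esub>
          (inv\<^bsub>Fn n\<^esub> a \<otimes>\<^bsub>Fn n\<^esub> b \<otimes>\<^bsub>Fn n\<^esub> a) \<otimes>\<^bsub>Fn n\<^esub> inv\<^bsub>Fn n\<^esub> a = b"
        if "a \<in> ?S" "b \<in> ?S" for a b
      proof -
        have "a \<otimes>\<^bsub>Fn n\<^esub> (inv\<^bsub>Fn n\<^esub> a \<otimes>\<^bsub>Fn n\<^esub> b) = b"
          using that by (simp add: G.m_assoc[symmetric])
        with that show ?thesis by (simp add: G.m_assoc)
      qed
      have "\<psi> (free_gen i) =
          inv\<^bsub>Fn n\<^esub> (inv\<^bsub>Fn n\<^esub> \<psi> f) \<otimes>\<^bsub>Fn n\<^esub> free_gen i \<otimes>\<^bsub>Fn n\<^esub> inv\<^bsub>Fn n\<^esub> \<psi> f"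
        using cancel[OF p.hom_closed[OF f] p.hom_closed[OF gen[OF i]]] unfolding dec by (rule sym)
      then show ?thesis
        by (rule bexI) (simp add: f)
    qed
    then show "inv\<^bsub>AutoGroup (Fn n)\<^esub> \<phi> \<in> basis_conj_auto n"
      using \<psi>a by (simp add: basis_conj_auto_def \<psi>_def[symmetric])
  next
    fix \<phi> \<psi> assume \<phi>: "\<phi> \<in> basis_conj_auto n" and \<psi>: "\<psi> \<in> basis_conj_auto n"
    have \<phi>a: "\<phi> \<in> auto (Fn n)" and \<psi>a: "\<psi> \<in> auto (Fn n)"
      using \<phi> \<psi> by (auto simp: basis_conj_auto_def)
    interpret f: group_hom "Fn n" "Fn n" \<phi> by (rule hom[OF \<phi>a])
    have "\<exists>h\<in>?S. \<phi> (\<psi> (free_gen i)) = inv\<^bsub>Fn n\<^esub> h \<otimes>\<^bsub>Fn n\<^esub> free_gen i \<otimes>\<^bsub>Fn n\<^esub> h" if i: "i \<in> {1..n}" for i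
    proof -
      from \<phi> \<psi> i obtain f g where f: "f \<in> ?S" "g \<in> ?S"
        and fi: "\<phi> (free_gen i) = inv\<^bsub>Fn n\<^esub> f \<otimes>\<^bsub>Fn n\<^esub> free_gen i \<otimes>\<^bsub>Fn n\<^esub> f"
        and gi: "\<psi> (free_gen i) = inv\<^bsub>Fn n\<^esub> g \<otimes>\<^bsub>Fn n\<^esub> free_gen i \<otimes>\<^bsub>Fn n\<^esub> g"
        unfolding basis_conj_auto_def by blast
      have "\<phi> (\<psi> (free_gen i)) =
          inv\<^bsub>Fn n\<^esub> (f \<otimes>\<^bsub>Fn n\<^esub> \<phi> g) \<otimes>\<^bsub>Fn n\<^esub> free_gen i \<otimes>\<^bsub>Fn n\<^esub> (f \<otimes>\<^bsub>Fn n\<^esub> \<phi> g)"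
        using f gen[OF i] by (simp add: fi gi G.m_assoc G.inv_mult_group)
      then show ?thesis
        by (rule bexI) (simp add: f)
    qed
    moreover have "compose ?S \<phi> \<psi> \<in> auto (Fn n)"
      using A.m_closed[of \<phi> \<psi>] \<phi>a \<psi>a by (simp add: auto_mult carr)
    ultimately show "\<phi> \<otimes>\<^bsub>AutoGroup (Fn n)\<^esub> \<psi> \<in> basis_conj_auto n"
      using gen by (simp add: auto_mult[OF \<phi>a \<psi>a] basis_conj_auto_def compose_eq)
  qed
qed

lemma group_Cb: "group (Cb n)"
  using group_free_group[of "{1..n}"] unfolding Cb_def
  by (intro subgroup.subgroup_is_group subgroup_basis_conj_auto group.AutoGroup) (simp add: Fn_def)


section \<open>Verbal subgroups and width\<close>

definition word_values :: "('g, 'm) monoid_scheme \<Rightarrow> 'v word set \<Rightarrow> 'g set" where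
  "word_values G V =
     {word_value G \<sigma> w | \<sigma> w. w \<in> V \<union> inv_word ` V \<and> (\<forall>x. \<sigma> x \<in> carrier G)}"

definition verbal_subgroup :: "('g, 'm) monoid_scheme \<Rightarrow> 'v word set \<Rightarrow> 'g set" where
  "verbal_subgroup G V = generate G (word_values G V)"

definition group_product :: "('g, 'm) monoid_scheme \<Rightarrow> 'g list \<Rightarrow> 'g" where
  "group_product G gs = foldr (mult G) gs \<one>\<^bsub>G\<^esub>"

text \<open>In \<^typ>\<open>enat\<close> the infimum of the empty set is \<open>\<infinity>\<close>.\<close>

definition width :: "('g, 'm) monoid_scheme \<Rightarrow> 'v word set \<Rightarrow> enat" where
  "width G V = Inf {enat m | m. \<forall>g\<in>verbal_subgroup G V. \<exists>gs.
     length gs \<le> m \<and> set gs \<subseteq> word_values G V \<and> g = group_product G gs}"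

definition proper_subgroup :: "'g set \<Rightarrow> ('g, 'm) monoid_scheme \<Rightarrow> bool" where
  "proper_subgroup H G \<longleftrightarrow> subgroup H G \<and> H \<noteq> {\<one>\<^bsub>G\<^esub>} \<and> H \<noteq> carrier G"

definition proper_words :: "'v word set \<Rightarrow> bool" where
  "proper_words V \<longleftrightarrow> proper_subgroup (verbal_subgroup (Fn 2) V) (Fn 2)"

end

theory Submission
  imports Defs
begin

text \<open>
  Killing the generators \<open>x\<^sub>3, \<dots>, x\<^sub>n\<close> turns a basis-conjugating automorphism of
  \<open>F\<^sub>n\<close> into a surjective endomorphism of \<open>F\<^sub>2\<close> that conjugates each of the two generators,
  and such an endomorphism is inner (\<open>surj_conjugating_endo_inner\<close>). Because \<open>F\<^sub>2\<close> has
  trivial centre, the conjugating element is unique, so \<open>Cb\<^sub>n\<close> maps homomorphically to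
  \<open>F\<^sub>2\<close>; this map is onto, since the inner automorphisms of \<open>F\<^sub>n\<close> are basis-conjugating
  (\<open>Cb_onto_F2\<close>). Width does not increase under surjective homomorphisms
  (\<open>width_infinite_if_image\<close>). What remains is the theorem, due to Rhemtulla, that proper verbal
  subgroups of a free group have infinite width (\<open>width_free_group_infinite\<close>).

  For the latter, fix a generator \<open>x\<close> and let \<open>\<delta>\<^sub>k(w)\<close> be the number of maximal blocks
  \<open>x\<^sup>k\<close> in the reduced word \<open>w\<close> minus the number of maximal blocks \<open>x\<^sup>-\<^sup>k\<close>. Inversion
  changes the sign of \<open>\<delta>\<^sub>k\<close>. A product \<open>uv\<close> is formed by cancelling a common part and
  concatenating the rest, which disturbs only the blocks at the places of cutting and gluing; hence
  \<open>\<delta>\<^sub>k(uv) = \<delta>\<^sub>k(u) + \<delta>\<^sub>k(v)\<close> for all but boundedly many \<open>k\<close>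
  (\<open>syllables_mult_almost\<close>). The bound depends on neither \<open>u\<close> nor \<open>v\<close>. Consequently, for a
  value \<open>v(g\<^sub>1, g\<^sub>2, \<dots>)\<close> of a word \<open>v\<close>, the number \<open>\<delta>\<^sub>k\<close> is
  \<open>\<Sum>\<^sub>i e\<^sub>i \<delta>\<^sub>k(g\<^sub>i)\<close> for all but boundedly many \<open>k\<close>, where \<open>e\<^sub>i\<close> is the
  exponent sum of the \<open>i\<close>-th variable.

  If the verbal subgroup of \<open>V\<close> is not the whole group, then some \<open>d\<close> other than \<open>1\<close> and
  \<open>-1\<close> divides all exponent sums of words in \<open>V\<close>
  (\<open>verbal_subgroup_exponent_modulus\<close>); \<open>d = 0\<close> is possible. So
  \<open>d\<close> divides \<open>\<delta>\<^sub>k\<close> of a value for all but boundedly many \<open>k\<close>, and the number of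
  exceptional \<open>k\<close> grows at most linearly with the number of values multiplied
  (\<open>syllable_support_group_product\<close>).

  If the verbal subgroup is not trivial either, it contains a reduced word \<open>u\<close> whose first and
  last letters are not \<open>x\<close> or its inverse, and hence, being normal, all products
  \<open>\<Prod>\<^sub>i x\<^bsup>-c\<^sub>i\<^esup> u x\<^bsup>c\<^sub>i\<^esup>\<close>. Each conjugate alone contributes two blocks that
  cancel in \<open>\<delta>\<close>, but inside the product neighbouring blocks merge to
  \<open>x\<^bsup>c\<^sub>i - c\<^sub>i\<^sub>+\<^sub>1\<^esup>\<close>. When the \<open>c\<^sub>i\<close> grow with increasing
  differences larger than the length of \<open>u\<close>, these blocks have distinct lengths, and
  \<open>\<delta>\<^sub>k = -1\<close> for at least \<open>N - 1\<close> numbers \<open>k\<close> if there are \<open>N\<close> factors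
  (\<open>card_syllable_support_staircase\<close>). Since \<open>d\<close> does not divide \<open>-1\<close>,
  no fixed number of values suffices.
\<close>


section \<open>Reduced words\<close>

lemma reduced_append_iff:
  "reduced (u @ v) \<longleftrightarrow>
     reduced u \<and> reduced v \<and> (u \<noteq> [] \<longrightarrow> v \<noteq> [] \<longrightarrow> hd v \<noteq> inv_letter (last u))"
  by (auto simp: reduced_def successively_append_iff)

lemma reduced_Cons_iff: "reduced (l # w) \<longleftrightarrow> reduced w \<and> (w \<noteq> [] \<longrightarrow> hd w \<noteq> inv_letter l)"
  by (cases w) auto

lemma inv_letter_neq [simp]: "inv_letter l \<noteq> l" "l \<noteq> inv_letter l"
  by (auto simp: inv_letter_def prod_eq_iff)

lemma inv_letter_eq_iff [simp]: "inv_letter l = inv_letter m \<longleftrightarrow> l = m"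
  by (metis inv_letter_inv_letter)

lemma reduced_replicate: "reduced (replicate m l)"
  by (induction m) (auto simp: reduced_Cons_iff)

lemma inv_word_append: "inv_word (u @ v) = inv_word v @ inv_word u"
  by (simp add: inv_word_def)

lemma inv_word_simps [simp]: "inv_word [] = []" "inv_word (l # w) = inv_word w @ [inv_letter l]"
  by (simp_all add: inv_word_def)

lemma inv_word_inv_word [simp]: "inv_word (inv_word w) = w"
  by (simp add: inv_word_def rev_map comp_def)

lemma inv_word_eq_Nil [simp]: "inv_word w = [] \<longleftrightarrow> w = []"
  by (simp add: inv_word_def)

lemma hd_inv_word: "w \<noteq> [] \<Longrightarrow> hd (inv_word w) = inv_letter (last w)"
  by (simp add: inv_word_def hd_rev last_map)

lemma last_inv_word: "w \<noteq> [] \<Longrightarrow> last (inv_word w) = inv_letter (hd w)"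
  by (simp add: inv_word_def last_rev hd_map)

lemma reduced_inv_word: "reduced (inv_word w) \<longleftrightarrow> reduced w"
proof (induction w)
  case (Cons l w)
  then show ?case
    by (cases w) (auto simp: reduced_append_iff last_inv_word)
qed simp

lemma fst_set_inv_word: "fst ` set (inv_word w) = fst ` set w"
  by (force simp: inv_word_def image_iff)

lemma foldr_push_eq_append: "reduced (u @ v) \<Longrightarrow> foldr push_letter u v = u @ v"
proof (induction u)
  case (Cons l u)
  then show ?case by (cases "u @ v") (auto simp: reduced_Cons_iff)
qed simp

text \<open>The product of two reduced words cancels a common part \<open>c\<close> and nothing else.\<close>

lemma foldr_push_cancel:
  assumes "reduced u" "reduced v"
  shows "\<exists>p c q. u = p @ c \<and> v = inv_word c @ q \<and> reduced (p @ q) \<and> foldr push_letter u v = p @ q"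
  using assms
proof (induction u)
  case Nil
  then show ?case by (intro exI[of _ "[]"] exI[of _ v]) auto
next
  case (Cons l u)
  then have "reduced u" by (simp add: reduced_Cons_iff)
  with Cons obtain p c q where *: "u = p @ c" "v = inv_word c @ q" "reduced (p @ q)"
      "foldr push_letter u v = p @ q"
    by blast
  consider q' where "p = []" "q = inv_letter l # q'" | "reduced (l # p @ q)"
    using * Cons.prems(1) by (cases p; cases q) (auto simp: reduced_Cons_iff)
  then show ?case
  proof cases
    case (1 q')
    with * show ?thesis
      by (intro exI[of _ "[]"] exI[of _ "l # u"] exI[of _ q']) (auto simp: reduced_Cons_iff)
  next
    case 2
    with * show ?thesis
      by (intro exI[of _ "l # p"] exI[of _ c] exI[of _ q])
         (auto simp: foldr_push_eq_append[of "[l]", simplified])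
  qed
qed

lemma carrier_free_group: "w \<in> carrier (free_group S) \<longleftrightarrow> reduced w \<and> fst ` set w \<subseteq> S"
  by (simp add: free_group_def)

lemma mult_free_group: "u \<otimes>\<^bsub>free_group S\<^esub> v = reduce_word (u @ v)"
  by (simp add: free_group_def)

lemma one_free_group: "\<one>\<^bsub>free_group S\<^esub> = []"
  by (simp add: free_group_def)

lemma mult_free_group_foldr:
  "v \<in> carrier (free_group S) \<Longrightarrow> u \<otimes>\<^bsub>free_group S\<^esub> v = foldr push_letter u v"
  by (simp add: mult_free_group reduce_word_append reduce_word_reduced carrier_free_group)

lemma mult_free_group_reduced: "reduced (u @ v) \<Longrightarrow> u \<otimes>\<^bsub>free_group S\<^esub> v = u @ v"
  by (simp add: mult_free_group reduce_word_reduced)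

lemma inv_word_in_carrier:
  "w \<in> carrier (free_group S) \<Longrightarrow> inv_word w \<in> carrier (free_group S)"
  by (simp add: carrier_free_group reduced_inv_word fst_set_inv_word)

lemma inv_free_group:
  assumes "w \<in> carrier (free_group S)"
  shows "inv\<^bsub>free_group S\<^esub> w = inv_word w"
  using assms
  by (intro group.inv_equality[OF group_free_group])
     (simp_all add: inv_word_in_carrier mult_free_group_foldr reduce_inv_word one_free_group)


section \<open>Word values\<close>

context group
begin

lemma letter_value_closed: "\<sigma> (fst l) \<in> carrier G \<Longrightarrow> letter_value G \<sigma> l \<in> carrier G"
  by (simp add: letter_value_def)

lemma word_value_Nil [simp]: "word_value G \<sigma> [] = \<one>"
  by (simp add: word_value_def)

lemma word_value_Cons [simp]: "word_value G \<sigma> (l # w) = letter_value G \<sigma> l \<otimes> word_value G \<sigma> w"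
  by (simp add: word_value_def)

lemma word_value_closed:
  assumes "\<And>x. x \<in> fst ` set w \<Longrightarrow> \<sigma> x \<in> carrier G"
  shows "word_value G \<sigma> w \<in> carrier G"
  using assms by (induction w) (auto intro!: letter_value_closed m_closed)

lemma word_value_append:
  assumes "\<And>x. x \<in> fst ` set (u @ v) \<Longrightarrow> \<sigma> x \<in> carrier G"
  shows "word_value G \<sigma> (u @ v) = word_value G \<sigma> u \<otimes> word_value G \<sigma> v"
  using assms
proof (induction u)
  case (Cons l u)
  have "word_value G \<sigma> u \<in> carrier G" "word_value G \<sigma> v \<in> carrier G" "letter_value G \<sigma> l \<in> carrier G"
    using Cons.prems by (auto intro!: word_value_closed letter_value_closed)
  with Cons show ?case by (simp add: m_assoc)
qed (simp add: word_value_closed)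

lemma letter_value_inv_letter:
  "\<sigma> (fst l) \<in> carrier G \<Longrightarrow> letter_value G \<sigma> (inv_letter l) = inv (letter_value G \<sigma> l)"
  by (auto simp: letter_value_def inv_letter_def)

lemma word_value_push_letter:
  assumes "\<sigma> (fst l) \<in> carrier G" "\<And>x. x \<in> fst ` set w \<Longrightarrow> \<sigma> x \<in> carrier G"
  shows "word_value G \<sigma> (push_letter l w) = letter_value G \<sigma> l \<otimes> word_value G \<sigma> w"
proof (cases w)
  case (Cons m v)
  show ?thesis
  proof (cases "m = inv_letter l")
    case True
    have "letter_value G \<sigma> l \<in> carrier G" "word_value G \<sigma> v \<in> carrier G"
      using assms Cons by (auto intro!: word_value_closed letter_value_closed)
    then show ?thesis
      using assms Cons True by (simp add: letter_value_inv_letter m_assoc[symmetric])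
  qed (simp add: Cons)
qed simp

lemma word_value_reduce_word:
  assumes "\<And>x. x \<in> fst ` set w \<Longrightarrow> \<sigma> x \<in> carrier G"
  shows "word_value G \<sigma> (reduce_word w) = word_value G \<sigma> w"
  using assms
proof (induction w)
  case (Cons l w)
  have "reduce_word (l # w) = push_letter l (reduce_word w)"
    by (simp add: reduce_word_def)
  moreover have "word_value G \<sigma> (push_letter l (reduce_word w)) =
      letter_value G \<sigma> l \<otimes> word_value G \<sigma> (reduce_word w)"
    using Cons.prems fst_set_reduce_word[of w] by (intro word_value_push_letter) auto
  ultimately show ?case using Cons by simp
qed (simp add: reduce_word_def)

text \<open>The existence half of the universal property of the free group; \<open>homs_free_group_eqI\<close>
  is the uniqueness half.\<close>

lemma word_value_hom:
  assumes "\<And>x. x \<in> S \<Longrightarrow> \<sigma> x \<in> carrier G"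
  shows "word_value G \<sigma> \<in> hom (free_group S) G"
proof (rule homI)
  fix u assume "u \<in> carrier (free_group S)"
  then show "word_value G \<sigma> u \<in> carrier G"
    using assms by (intro word_value_closed) (auto simp: carrier_free_group)
next
  fix u v assume "u \<in> carrier (free_group S)" "v \<in> carrier (free_group S)"
  then have S: "\<sigma> x \<in> carrier G" if "x \<in> fst ` set (u @ v)" for x
    using assms that by (auto simp: carrier_free_group)
  show "word_value G \<sigma> (u \<otimes>\<^bsub>free_group S\<^esub> v) = word_value G \<sigma> u \<otimes> word_value G \<sigma> v"
    by (simp only: mult_free_group word_value_reduce_word[OF S] word_value_append[OF S])
qed

lemma word_value_cong:
  assumes "\<And>x. x \<in> fst ` set w \<Longrightarrow> \<sigma> x = \<tau> x"
  shows "word_value G \<sigma> w = word_value G \<tau> w"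
  using assms by (induction w) (auto simp: letter_value_def)

end

lemma (in group_hom) hom_word_value:
  assumes "\<And>x. x \<in> fst ` set w \<Longrightarrow> \<sigma> x \<in> carrier G"
  shows "h (word_value G \<sigma> w) = word_value H (h \<circ> \<sigma>) w"
  using assms
proof (induction w)
  case (Cons l w)
  have "word_value G \<sigma> w \<in> carrier G" "letter_value G \<sigma> l \<in> carrier G"
    using Cons.prems by (auto intro!: G.word_value_closed G.letter_value_closed)
  moreover have "h (letter_value G \<sigma> l) = letter_value H (h \<circ> \<sigma>) l"
    using Cons.prems by (simp add: letter_value_def)
  moreover have "h (word_value G \<sigma> w) = word_value H (h \<circ> \<sigma>) w"
    by (rule Cons.IH) (use Cons.prems in auto)
  ultimately show ?case by (simp only: G.word_value_Cons H.word_value_Cons hom_mult)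
qed simp

lemma free_gen_carrier [simp]: "free_gen x \<in> carrier (free_group S) \<longleftrightarrow> x \<in> S"
  by (simp add: carrier_free_group free_gen_def)

lemma inv_free_gen: "x \<in> S \<Longrightarrow> inv\<^bsub>free_group S\<^esub> (free_gen x) = [(x, False)]"
  using inv_free_group[of "free_gen x" S]
  by (simp add: carrier_free_group free_gen_def inv_letter_def)

lemma letter_value_free_gen:
  "fst l \<in> S \<Longrightarrow> letter_value (free_group S) free_gen l = [l]"
  by (cases l) (auto simp: letter_value_def inv_free_gen, simp add: free_gen_def)

lemma word_value_free_gen:
  assumes "fst ` set w \<subseteq> S"
  shows "word_value (free_group S) free_gen w = reduce_word w"
proof -
  interpret F: group "free_group S" by (rule group_free_group)
  show ?thesis using assms
  proof (induction w)
    case (Cons l w)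
    then have "[l] \<otimes>\<^bsub>free_group S\<^esub> reduce_word w = foldr push_letter [l] (reduce_word w)"
      using fst_set_reduce_word[of w] by (intro mult_free_group_foldr) (auto simp: carrier_free_group)
    with Cons show ?case by (simp add: letter_value_free_gen reduce_word_def)
  qed (simp add: one_free_group reduce_word_def)
qed

lemma hom_free_group_eq_word_value:
  assumes "group G" "h \<in> hom (free_group S) G" "w \<in> carrier (free_group S)"
  shows "h w = word_value G (h \<circ> free_gen) w"
proof -
  interpret group_hom "free_group S" G h
    using assms by (simp add: group_hom_def group_hom_axioms_def group_free_group)
  have "w = word_value (free_group S) free_gen w"
    using assms(3) by (simp add: word_value_free_gen carrier_free_group reduce_word_reduced)
  moreover have "free_gen x \<in> carrier (free_group S)" if "x \<in> fst ` set w" for x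
    using assms(3) that by (auto simp: carrier_free_group free_gen_def)
  ultimately show ?thesis
    using hom_word_value[of w free_gen] by metis
qed


section \<open>Verbal subgroups and width\<close>

context group
begin

lemma word_values_closed: "word_values G V \<subseteq> carrier G"
  by (auto simp: word_values_def intro: word_value_closed)

lemma word_value_in_verbal_subgroup:
  "w \<in> V \<Longrightarrow> (\<And>x. \<sigma> x \<in> carrier G) \<Longrightarrow> word_value G \<sigma> w \<in> verbal_subgroup G V"
  unfolding verbal_subgroup_def by (rule generate.incl) (auto simp: word_values_def)

lemma inner_hom:
  assumes "g \<in> carrier G"
  shows "group_hom G G (\<lambda>x. g \<otimes> x \<otimes> inv g)"
proof (unfold_locales, rule homI)
  fix x y assume "x \<in> carrier G" "y \<in> carrier G"
  moreover from this assms have "inv g \<otimes> (g \<otimes> (y \<otimes> inv g)) = y \<otimes> inv g"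
    by (simp add: m_assoc[symmetric])
  ultimately show "g \<otimes> (x \<otimes> y) \<otimes> inv g = g \<otimes> x \<otimes> inv g \<otimes> (g \<otimes> y \<otimes> inv g)"
    using assms by (simp add: m_assoc)
qed (use assms in auto)

lemma verbal_subgroup_normal: "verbal_subgroup G V \<lhd> G"
  unfolding verbal_subgroup_def
proof (rule normal_generateI[OF word_values_closed])
  fix h g assume "h \<in> word_values G V" and g: "g \<in> carrier G"
  then obtain \<sigma> w where w: "w \<in> V \<union> inv_word ` V" "\<And>x. \<sigma> x \<in> carrier G" "h = word_value G \<sigma> w"
    by (auto simp: word_values_def)
  interpret c: group_hom G G "\<lambda>x. g \<otimes> x \<otimes> inv g" by (rule inner_hom[OF g])
  have "g \<otimes> h \<otimes> inv g = word_value G ((\<lambda>x. g \<otimes> x \<otimes> inv g) \<circ> \<sigma>) w"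
    using c.hom_word_value[of w \<sigma>] w by simp
  with w g show "g \<otimes> h \<otimes> inv g \<in> word_values G V"
    unfolding word_values_def
    by (intro CollectI exI[of _ "(\<lambda>x. g \<otimes> x \<otimes> inv g) \<circ> \<sigma>"] exI[of _ w]) simp
qed

lemma group_product_closed: "set gs \<subseteq> carrier G \<Longrightarrow> group_product G gs \<in> carrier G"
  by (induction gs) (auto simp: group_product_def)

lemma group_product_simps [simp]:
  "group_product G [] = \<one>" "group_product G (g # gs) = g \<otimes> group_product G gs"
  by (simp_all add: group_product_def)

end

lemma width_finiteE:
  assumes "width G V \<noteq> \<infinity>"
  obtains m where "\<And>g. g \<in> verbal_subgroup G V \<Longrightarrow>
    \<exists>gs. length gs \<le> m \<and> set gs \<subseteq> word_values G V \<and> g = group_product G gs"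
proof -
  have "{enat m | m. \<forall>g\<in>verbal_subgroup G V. \<exists>gs.
     length gs \<le> m \<and> set gs \<subseteq> word_values G V \<and> g = group_product G gs} \<noteq> {}"
  proof
    assume *: "{enat m | m. \<forall>g\<in>verbal_subgroup G V. \<exists>gs.
       length gs \<le> m \<and> set gs \<subseteq> word_values G V \<and> g = group_product G gs} = {}"
    have "width G V = \<infinity>" unfolding width_def * by (simp add: top_enat_def)
    with assms show False by simp
  qed
  then show ?thesis using that by blast
qed

lemma width_finiteI:
  assumes "\<And>g. g \<in> verbal_subgroup G V \<Longrightarrow>
    \<exists>gs. length gs \<le> m \<and> set gs \<subseteq> word_values G V \<and> g = group_product G gs"
  shows "width G V \<noteq> \<infinity>"
proof -
  have "width G V \<le> enat m"
    unfolding width_def using assms by (intro Inf_lower) blast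
  then show ?thesis by (metis enat_ord_simps(5) infinity_ileE)
qed

lemma (in group_hom) hom_word_values: "h ` word_values G V \<subseteq> word_values H V"
proof
  fix y assume "y \<in> h ` word_values G V"
  then obtain \<sigma> w where w: "w \<in> V \<union> inv_word ` V" "\<And>x. \<sigma> x \<in> carrier G" "y = h (word_value G \<sigma> w)"
    by (auto simp: word_values_def)
  then have "y = word_value H (h \<circ> \<sigma>) w" using hom_word_value[of w \<sigma>] by simp
  with w show "y \<in> word_values H V"
    unfolding word_values_def by (intro CollectI exI[of _ "h \<circ> \<sigma>"] exI[of _ w]) simp
qed

lemma (in group_hom) hom_word_values_surj:
  assumes "h ` carrier G = carrier H"
  shows "h ` word_values G V = word_values H V"
proof (rule antisym[OF hom_word_values] subsetI)
  show "word_values H V \<subseteq> h ` word_values G V"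
  proof
    fix y assume "y \<in> word_values H V"
    then obtain \<tau> w where w: "w \<in> V \<union> inv_word ` V" "\<And>x. \<tau> x \<in> carrier H" "y = word_value H \<tau> w"
      by (auto simp: word_values_def)
    then have "\<exists>g\<in>carrier G. h g = \<tau> x" for x using assms by (metis imageE)
    then obtain \<sigma> where \<sigma>: "\<And>x. \<sigma> x \<in> carrier G" "\<And>x. h (\<sigma> x) = \<tau> x" by metis
    have "h \<circ> \<sigma> = \<tau>" using \<sigma>(2) by auto
    then have "y = h (word_value G \<sigma> w)" using w \<sigma> hom_word_value[of w \<sigma>] by simp
    then show "y \<in> h ` word_values G V" using w(1) \<sigma>(1) by (auto simp: word_values_def)
  qed
qed

lemma (in group_hom) hom_group_product:
  "set gs \<subseteq> carrier G \<Longrightarrow> h (group_product G gs) = group_product H (map h gs)"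
  by (induction gs) (auto simp: G.group_product_closed)

text \<open>Values of words, and products of them, lift along a surjective homomorphism and are preserved by
  it, so a bound for the source is a bound for the image.\<close>

lemma (in group_hom) width_infinite_if_image:
  assumes surj: "h ` carrier G = carrier H" and "width H V = \<infinity>"
  shows "width G V = \<infinity>"
proof (rule ccontr)
  assume "width G V \<noteq> \<infinity>"
  then obtain m where m: "\<And>g. g \<in> verbal_subgroup G V \<Longrightarrow>
      \<exists>gs. length gs \<le> m \<and> set gs \<subseteq> word_values G V \<and> g = group_product G gs"
    using width_finiteE by blast
  have gen: "verbal_subgroup H V = h ` verbal_subgroup G V"
    unfolding verbal_subgroup_def hom_word_values_surj[OF surj, symmetric]
    by (rule generate_img[OF G.word_values_closed])
  have "width H V \<noteq> \<infinity>"
  proof (rule width_finiteI)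
    fix y assume "y \<in> verbal_subgroup H V"
    then obtain g where g: "g \<in> verbal_subgroup G V" "y = h g" unfolding gen by blast
    with m obtain gs where gs: "length gs \<le> m" "set gs \<subseteq> word_values G V" "g = group_product G gs"
      by blast
    have "y = group_product H (map h gs)"
      using hom_group_product[OF subset_trans[OF gs(2) G.word_values_closed]] gs(3) g(2) by simp
    moreover have "set (map h gs) \<subseteq> word_values H V"
      using gs(2) hom_word_values by auto
    ultimately show "\<exists>hs. length hs \<le> m \<and> set hs \<subseteq> word_values H V \<and> y = group_product H hs"
      using gs(1) by (intro exI[of _ "map h gs"]) simp
  qed
  with assms show False by simp
qed


section \<open>Counting syllables\<close>

text \<open>The number of maximal blocks of \<open>a\<close> of length \<open>k\<close> in \<open>w\<close>, where \<open>j\<close> letters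
  \<open>a\<close> have already been read before \<open>w\<close>. Every letter other than \<open>a\<close>, and the end
  of the word, closes a block, so an empty block is recorded at each closing position that is not
  preceded by \<open>a\<close>. With this convention the identities below hold for all \<open>k\<close>, including
  \<open>k = 0\<close>, and say exactly which block lengths gain or lose one.\<close>

fun run_count :: "'v letter \<Rightarrow> nat \<Rightarrow> nat \<Rightarrow> 'v word \<Rightarrow> int" where
  "run_count a k j [] = of_bool (j = k)"
| "run_count a k j (b # w) =
     (if b = a then run_count a k (Suc j) w else of_bool (j = k) + run_count a k 0 w)"

text \<open>Starting with \<open>j\<close> letters \<open>a\<close> in hand only changes the leading block, from its
  length \<open>r\<close> to \<open>j + r\<close>.\<close>

lemma run_count_start:
  "\<exists>r. \<forall>k j. run_count a k j w = run_count a k 0 w - of_bool (r = k) + of_bool (j + r = k)"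
proof (induction w)
  case Nil
  show ?case by (rule exI[of _ 0]) auto
next
  case (Cons b w)
  then obtain r where r: "\<And>k j. run_count a k j w =
      run_count a k 0 w - of_bool (r = k) + of_bool (j + r = k)" by blast
  show ?case
  proof (cases "b = a")
    case True
    have "run_count a k j (b # w) =
        run_count a k 0 (b # w) - of_bool (Suc r = k) + of_bool (j + Suc r = k)" for k j
      using r[of k "Suc j"] r[of k "Suc 0"] True by simp
    then show ?thesis by blast
  qed (rule exI[of _ 0], simp)
qed

text \<open>Here \<open>s\<close> is the length of the block still open at the end of \<open>p\<close>.\<close>

lemma run_count_append:
  "\<exists>s. \<forall>k q. run_count a k j (p @ q) = run_count a k j p - of_bool (s = k) + run_count a k s q"
proof (induction p arbitrary: j)
  case Nil
  show ?case by (rule exI[of _ j]) auto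
next
  case (Cons b p)
  show ?case
  proof (cases "b = a")
    case True
    with Cons.IH[of "Suc j"] show ?thesis by simp
  next
    case False
    with Cons.IH[of 0] show ?thesis by (simp add: algebra_simps)
  qed
qed

lemma run_count_append_break:
  assumes "b \<noteq> a"
  shows "run_count a k j (p @ b # q) = run_count a k j p + run_count a k 0 q"
proof -
  obtain s where "\<And>k q. run_count a k j (p @ q) =
      run_count a k j p - of_bool (s = k) + run_count a k s q"
    using run_count_append by blast
  from this[of k "b # q"] assms show ?thesis by simp
qed

lemma run_count_replicate: "run_count a k j (replicate m a) = of_bool (j + m = k)"
  by (induction m arbitrary: j) auto

lemma leading_run_cases:
  obtains m where "w = replicate m a"
  | m b v where "w = replicate m a @ b # v" "b \<noteq> a"
proof (induction w arbitrary: thesis)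
  case Nil
  from Nil(1)[of 0] show ?case by simp
next
  case (Cons c w)
  show ?case
  proof (cases "c = a")
    case True
    show ?thesis
    proof (rule Cons.IH)
      fix m assume "w = replicate m a"
      then show thesis using Cons.prems(1)[of "Suc m"] True by simp
    next
      fix m b v assume "w = replicate m a @ b # v" "b \<noteq> a"
      then show thesis using Cons.prems(2)[of "Suc m" b v] True by simp
    qed
  next
    case False
    then show ?thesis using Cons.prems(2)[of 0 c w] by simp
  qed
qed

text \<open>Blocks do not depend on the reading direction, although \<^const>\<open>run_count\<close> reads from the
  left; the proof splits off the leading block together with the letter that closes it.\<close>

lemma run_count_rev: "run_count a k 0 (rev w) = run_count a k 0 w"
proof (induction w rule: length_induct)
  case (1 w)
  show ?case
  proof (cases w a rule: leading_run_cases)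
    case (2 m b v)
    then have "length v < length w" by simp
    with 1 have "run_count a k 0 (rev v) = run_count a k 0 v" by blast
    with 2 show ?thesis by (simp add: run_count_append_break run_count_replicate)
  qed simp
qed

lemma run_count_map_inv_letter:
  "run_count a k j (map inv_letter w) = run_count (inv_letter a) k j w"
proof (induction w arbitrary: j)
  case (Cons b w)
  have "inv_letter b = a \<longleftrightarrow> b = inv_letter a" by auto
  with Cons show ?case by simp
qed simp

lemma run_count_inv_word: "run_count a k 0 (inv_word w) = run_count (inv_letter a) k 0 w"
  by (simp add: inv_word_def run_count_rev run_count_map_inv_letter)

lemma run_count_long: "j + length w < k \<Longrightarrow> run_count a k j w = 0"
  by (induction w arbitrary: j) auto

text \<open>Two words can be glued without disturbing the count as soon as one of them has a letter other
  than \<open>a\<close> at the junction. Gluing removes one empty block, which is why \<open>k\<close> is positive.\<close>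

lemma run_count_append_last:
  assumes "k > 0" "p = [] \<or> last p \<noteq> a"
  shows "run_count a k 0 (p @ q) = run_count a k 0 p + run_count a k 0 q"
  using assms by (cases p rule: rev_cases) (auto simp: run_count_append_break)

lemma run_count_append_hd:
  assumes "k > 0" "q = [] \<or> hd q \<noteq> a"
  shows "run_count a k 0 (p @ q) = run_count a k 0 p + run_count a k 0 q"
  using assms by (cases q) (auto simp: run_count_append_break)

text \<open>The counting function \<open>\<delta>\<^sub>k\<close>. Taking the difference makes it odd under
  inversion, so that the parts cancelled in a product contribute nothing.\<close>

definition syllables :: "'v letter \<Rightarrow> 'v word \<Rightarrow> nat \<Rightarrow> int" where
  "syllables a w k = run_count a k 0 w - run_count (inv_letter a) k 0 w"

lemma syllables_Nil [simp]: "syllables a [] k = 0"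
  by (simp add: syllables_def)

lemma syllables_inv_word: "syllables a (inv_word w) k = - syllables a w k"
  by (simp add: syllables_def run_count_inv_word)

text \<open>Gluing replaces blocks of lengths \<open>s\<close> and \<open>r\<close> by one of length \<open>s + r\<close>.\<close>

lemma run_count_append_almost:
  "\<exists>B. finite B \<and> card B \<le> 3 \<and>
     (\<forall>k. k \<notin> B \<longrightarrow> run_count a k 0 (p @ q) = run_count a k 0 p + run_count a k 0 q)"
proof -
  obtain s where s: "\<And>k q. run_count a k 0 (p @ q) =
      run_count a k 0 p - of_bool (s = k) + run_count a k s q"
    using run_count_append by blast
  obtain r where r: "\<And>k j. run_count a k j q =
      run_count a k 0 q - of_bool (r = k) + of_bool (j + r = k)"
    using run_count_start by blast
  show ?thesis
  proof (intro exI[of _ "{s, r, s + r}"] conjI allI impI)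
    fix k assume "k \<notin> {s, r, s + r}"
    then show "run_count a k 0 (p @ q) = run_count a k 0 p + run_count a k 0 q"
      using s[of k q] r[of k s] by auto
  qed (simp_all add: card_insert_if)
qed

lemma syllables_append_almost:
  "\<exists>B. finite B \<and> card B \<le> 6 \<and>
     (\<forall>k. k \<notin> B \<longrightarrow> syllables a (p @ q) k = syllables a p k + syllables a q k)"
proof -
  obtain B where B: "finite B" "card B \<le> 3"
      "\<And>k. k \<notin> B \<Longrightarrow> run_count a k 0 (p @ q) = run_count a k 0 p + run_count a k 0 q"
    using run_count_append_almost by blast
  obtain C where C: "finite C" "card C \<le> 3"
      "\<And>k. k \<notin> C \<Longrightarrow> run_count (inv_letter a) k 0 (p @ q) =
         run_count (inv_letter a) k 0 p + run_count (inv_letter a) k 0 q"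
    using run_count_append_almost by blast
  have "card (B \<union> C) \<le> 6" using card_Un_le[of B C] B(2) C(2) by simp
  with B C show ?thesis by (intro exI[of _ "B \<union> C"]) (auto simp: syllables_def)
qed

text \<open>Writing \<open>u = p c\<close> and \<open>v = c\<^sup>-\<^sup>1 q\<close>, there are three junctions, in \<open>u\<close>, in
  \<open>v\<close> and in \<open>p q\<close>, with at most six exceptional block lengths each. The contributions of
  \<open>c\<close> and its inverse cancel.\<close>

lemma syllables_mult_almost:
  assumes "u \<in> carrier (free_group S)" "v \<in> carrier (free_group S)"
  shows "\<exists>B. finite B \<and> card B \<le> 18 \<and>
     (\<forall>k. k \<notin> B \<longrightarrow> syllables a (u \<otimes>\<^bsub>free_group S\<^esub> v) k = syllables a u k + syllables a v k)"
proof -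
  have red: "reduced u" "reduced v" using assms by (simp_all add: carrier_free_group)
  obtain p c q where pcq: "u = p @ c" "v = inv_word c @ q" "foldr push_letter u v = p @ q"
    using foldr_push_cancel[OF red] by (elim exE conjE)
  note prod = pcq(3)[folded mult_free_group_foldr[OF assms(2)]]
  obtain B1 where B1: "finite B1" "card B1 \<le> 6"
      "\<And>k. k \<notin> B1 \<Longrightarrow> syllables a (p @ q) k = syllables a p k + syllables a q k"
    using syllables_append_almost by blast
  obtain B2 where B2: "finite B2" "card B2 \<le> 6"
      "\<And>k. k \<notin> B2 \<Longrightarrow> syllables a (p @ c) k = syllables a p k + syllables a c k"
    using syllables_append_almost by blast
  obtain B3 where B3: "finite B3" "card B3 \<le> 6"
      "\<And>k. k \<notin> B3 \<Longrightarrow> syllables a (inv_word c @ q) k = syllables a (inv_word c) k + syllables a q k"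
    using syllables_append_almost by blast
  have "card (B1 \<union> B2 \<union> B3) \<le> 18"
    using card_Un_le[of "B1 \<union> B2" B3] card_Un_le[of B1 B2] B1(2) B2(2) B3(2) by simp
  moreover have "syllables a (u \<otimes>\<^bsub>free_group S\<^esub> v) k = syllables a u k + syllables a v k"
    if "k \<notin> B1 \<union> B2 \<union> B3" for k
    using B1(3)[of k] B2(3)[of k] B3(3)[of k] that
    unfolding prod unfolding pcq(1,2) by (simp add: syllables_inv_word)
  ultimately show ?thesis
    using B1(1) B2(1) B3(1) by (intro exI[of _ "B1 \<union> B2 \<union> B3"]) simp
qed


section \<open>Syllables of values\<close>

definition letter_sign :: "'v letter \<Rightarrow> int" where
  "letter_sign l = (if snd l then 1 else - 1)"

definition exponent_sum :: "'v \<Rightarrow> 'v word \<Rightarrow> int" where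
  "exponent_sum x w = (\<Sum>l\<leftarrow>w. if fst l = x then letter_sign l else 0)"

lemma exponent_sum_simps [simp]:
  "exponent_sum x [] = 0"
  "exponent_sum x (l # w) = (if fst l = x then letter_sign l else 0) + exponent_sum x w"
  by (simp_all add: exponent_sum_def)

lemma exponent_sum_append: "exponent_sum x (u @ v) = exponent_sum x u + exponent_sum x v"
  by (simp add: exponent_sum_def)

lemma exponent_sum_inv_word: "exponent_sum x (inv_word w) = - exponent_sum x w"
  by (induction w) (auto simp: exponent_sum_append letter_sign_def inv_letter_def)

lemma sum_letters_eq_exponent_sums:
  assumes "finite A" "fst ` set w \<subseteq> A"
  shows "(\<Sum>l\<leftarrow>w. letter_sign l * f (fst l)) = (\<Sum>x\<in>A. exponent_sum x w * f x)"
  using assms(2)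
proof (induction w)
  case (Cons l w)
  have "(\<Sum>x\<in>A. exponent_sum x (l # w) * f x) =
      (\<Sum>x\<in>A. (if x = fst l then letter_sign l * f (fst l) else 0) + exponent_sum x w * f x)"
    by (intro sum.cong) (auto simp: algebra_simps)
  also have "\<dots> = letter_sign l * f (fst l) + (\<Sum>x\<in>A. exponent_sum x w * f x)"
    using assms(1) Cons.prems by (simp add: sum.distrib)
  finally show ?case using Cons by simp
qed simp

text \<open>Substituting \<open>g\<close> for one variable and the identity for all others shows that powers of
  \<open>g\<close> with exponent an exponent sum lie in the verbal subgroup.\<close>

lemma (in group) word_value_single:
  assumes "g \<in> carrier G"
  shows "word_value G (\<lambda>y. if y = x then g else \<one>) w = g [^] exponent_sum x w"
proof (induction w)
  case (Cons l w)
  have "letter_value G (\<lambda>y. if y = x then g else \<one>) l =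
      g [^] (if fst l = x then letter_sign l else 0 :: int)"
    using assms by (auto simp: letter_value_def letter_sign_def int_pow_neg)
  with Cons assms show ?case by (simp only: word_value_Cons exponent_sum_simps int_pow_mult)
qed simp

lemma syllables_letter_value:
  assumes "\<sigma> (fst l) \<in> carrier (free_group S)"
  shows "syllables a (letter_value (free_group S) \<sigma> l) k = letter_sign l * syllables a (\<sigma> (fst l)) k"
  using assms by (simp add: letter_value_def letter_sign_def inv_free_group syllables_inv_word)

text \<open>Each letter of \<open>w\<close> costs one multiplication. The number of exceptions depends on the word
  only, not on the elements substituted.\<close>

lemma syllables_word_value_almost:
  assumes "\<And>x. \<sigma> x \<in> carrier (free_group S)"
  shows "\<exists>B. finite B \<and> card B \<le> 18 * length w \<and>
    (\<forall>k. k \<notin> B \<longrightarrow> syllables a (word_value (free_group S) \<sigma> w) k =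
       (\<Sum>l\<leftarrow>w. letter_sign l * syllables a (\<sigma> (fst l)) k))"
proof (induction w)
  interpret F: group "free_group S" by (rule group_free_group)
  case Nil
  show ?case by (intro exI[of _ "{}"]) (simp add: one_free_group)
next
  interpret F: group "free_group S" by (rule group_free_group)
  case (Cons l w)
  then obtain B where B: "finite B" "card B \<le> 18 * length w"
    "\<And>k. k \<notin> B \<Longrightarrow> syllables a (word_value (free_group S) \<sigma> w) k =
       (\<Sum>l\<leftarrow>w. letter_sign l * syllables a (\<sigma> (fst l)) k)" by blast
  have "letter_value (free_group S) \<sigma> l \<in> carrier (free_group S)"
    "word_value (free_group S) \<sigma> w \<in> carrier (free_group S)"
    using assms by (auto intro: F.letter_value_closed F.word_value_closed)
  from syllables_mult_almost[OF this, of a]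
  obtain C where C: "finite C" "card C \<le> 18"
    "\<And>k. k \<notin> C \<Longrightarrow> syllables a (word_value (free_group S) \<sigma> (l # w)) k =
       syllables a (letter_value (free_group S) \<sigma> l) k +
       syllables a (word_value (free_group S) \<sigma> w) k"
    by auto
  have "card (B \<union> C) \<le> 18 * length (l # w)"
    using card_Un_le[of B C] B(2) C(2) by simp
  moreover have "syllables a (word_value (free_group S) \<sigma> (l # w)) k =
       (\<Sum>l\<leftarrow>l # w. letter_sign l * syllables a (\<sigma> (fst l)) k)" if "k \<notin> B \<union> C" for k
    using B(3)[of k] C(3)[of k] that assms by (simp add: syllables_letter_value)
  ultimately show ?case
    using B(1) C(1) by (intro exI[of _ "B \<union> C"] conjI allI impI) simp_all
qed

text \<open>An element with a large support is not a product of few values. For \<open>d = 0\<close> the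
  support consists of the \<open>k\<close> with \<open>\<delta>\<^sub>k \<noteq> 0\<close>.\<close>

definition syllable_support :: "int \<Rightarrow> 'v letter \<Rightarrow> 'v word \<Rightarrow> nat set" where
  "syllable_support d a w = {k. \<not> d dvd syllables a w k}"

text \<open>Collecting the letters by variables turns the sum over the letters of \<open>w\<close> into a combination
  whose coefficients are exponent sums, all divisible by \<open>d\<close>.\<close>

lemma syllable_support_value:
  assumes "\<And>x. \<sigma> x \<in> carrier (free_group S)" and d: "\<And>x. d dvd exponent_sum x w"
  shows "\<exists>B. finite B \<and> card B \<le> 18 * length w \<and>
    syllable_support d a (word_value (free_group S) \<sigma> w) \<subseteq> B"
proof -
  obtain B where B: "finite B" "card B \<le> 18 * length w"
    "\<forall>k. k \<notin> B \<longrightarrow> syllables a (word_value (free_group S) \<sigma> w) k =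
       (\<Sum>l\<leftarrow>w. letter_sign l * syllables a (\<sigma> (fst l)) k)"
    using syllables_word_value_almost[where \<sigma> = \<sigma> and S = S and w = w and a = a, OF assms(1)]
    by (elim exE conjE)
  have "d dvd (\<Sum>l\<leftarrow>w. letter_sign l * syllables a (\<sigma> (fst l)) k)" for k
    using d sum_letters_eq_exponent_sums[of "fst ` set w" w "\<lambda>x. syllables a (\<sigma> x) k"]
    by (auto intro!: dvd_sum dvd_mult2)
  with B show ?thesis
    by (intro exI[of _ B]) (auto simp: syllable_support_def)
qed

lemma syllable_support_mult:
  assumes "u \<in> carrier (free_group S)" "v \<in> carrier (free_group S)"
  shows "\<exists>B. finite B \<and> card B \<le> 18 \<and> syllable_support d a (u \<otimes>\<^bsub>free_group S\<^esub> v)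
    \<subseteq> syllable_support d a u \<union> syllable_support d a v \<union> B"
proof -
  obtain B where B: "finite B" "card B \<le> 18" "\<And>k. k \<notin> B \<Longrightarrow>
      syllables a (u \<otimes>\<^bsub>free_group S\<^esub> v) k = syllables a u k + syllables a v k"
    using syllables_mult_almost[OF assms] by blast
  then show ?thesis
    by (intro exI[of _ B]) (auto simp: syllable_support_def)
qed

text \<open>Each further factor brings at most \<open>18 * L\<close> exceptions as a value of a word of length at
  most \<open>L\<close>, and \<open>18\<close> for the multiplication.\<close>

lemma syllable_support_group_product:
  assumes V: "\<And>w. w \<in> V \<Longrightarrow> length w \<le> L" "\<And>w x. w \<in> V \<Longrightarrow> d dvd exponent_sum x w"
    and "set gs \<subseteq> word_values (free_group S) V"
  shows "\<exists>B. finite B \<and> card B \<le> length gs * (18 * L + 18) \<and>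
    syllable_support d a (group_product (free_group S) gs) \<subseteq> B"
  using assms(3)
proof (induction gs)
  interpret F: group "free_group S" by (rule group_free_group)
  case Nil
  show ?case by (intro exI[of _ "{}"]) (simp add: one_free_group syllable_support_def)
next
  interpret F: group "free_group S" by (rule group_free_group)
  case (Cons g gs)
  then obtain B where B: "finite B" "card B \<le> length gs * (18 * L + 18)"
    "syllable_support d a (group_product (free_group S) gs) \<subseteq> B" by auto
  from Cons.prems obtain \<sigma> w where w: "w \<in> V \<union> inv_word ` V"
      "\<And>x. \<sigma> x \<in> carrier (free_group S)" "g = word_value (free_group S) \<sigma> w"
    by (auto simp: word_values_def)
  have len: "length w \<le> L" and dvd: "\<And>x. d dvd exponent_sum x w"
    using w(1) V by (auto simp: exponent_sum_inv_word) (auto simp: inv_word_def)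
  obtain C where C: "finite C" "card C \<le> 18 * length w" "syllable_support d a g \<subseteq> C"
    using syllable_support_value[where \<sigma> = \<sigma> and S = S and w = w and d = d and a = a,
      OF w(2) dvd, folded w(3)] by (elim exE conjE)
  have "g \<in> carrier (free_group S)" "group_product (free_group S) gs \<in> carrier (free_group S)"
    using Cons.prems F.word_values_closed by (auto intro!: F.group_product_closed)
  from syllable_support_mult[OF this, of d a] obtain D where D: "finite D" "card D \<le> 18"
    "syllable_support d a (group_product (free_group S) (g # gs)) \<subseteq>
       syllable_support d a g \<union> syllable_support d a (group_product (free_group S) gs) \<union> D"
    unfolding F.group_product_simps by (elim exE conjE)
  have "card (B \<union> C \<union> D) \<le> length (g # gs) * (18 * L + 18)"
    using card_Un_le[of "B \<union> C" D] card_Un_le[of B C] B(2) C(2) D(2) len by simp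
  moreover have "syllable_support d a (group_product (free_group S) (g # gs)) \<subseteq> B \<union> C \<union> D"
    using B(3) C(3) D(3) by blast
  ultimately show ?case
    using B(1) C(1) D(1) by (intro exI[of _ "B \<union> C \<union> D"] conjI) simp_all
qed


section \<open>Elements with many syllable lengths\<close>

lemma syllables_append_last:
  assumes "k > 0" "p = [] \<or> fst (last p) \<noteq> fst a"
  shows "syllables a (p @ q) k = syllables a p k + syllables a q k"
proof -
  have "p = [] \<or> last p \<noteq> a" "p = [] \<or> last p \<noteq> inv_letter a" using assms(2) by auto
  with assms(1) show ?thesis by (simp add: syllables_def run_count_append_last)
qed

lemma syllables_append_hd:
  assumes "k > 0" "q = [] \<or> fst (hd q) \<noteq> fst a"
  shows "syllables a (p @ q) k = syllables a p k + syllables a q k"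
proof -
  have "q = [] \<or> hd q \<noteq> a" "q = [] \<or> hd q \<noteq> inv_letter a" using assms(2) by auto
  with assms(1) show ?thesis by (simp add: syllables_def run_count_append_hd)
qed

lemma run_count_replicate_other: "b \<noteq> a \<Longrightarrow> k > 0 \<Longrightarrow> run_count a k 0 (replicate m b) = 0"
  by (induction m) auto

lemma syllables_replicate:
  assumes "k > 0"
  shows "syllables a (replicate m a) k = of_bool (m = k)"
    and "syllables a (replicate m (inv_letter a)) k = - of_bool (m = k)"
  using assms by (simp_all add: syllables_def run_count_replicate run_count_replicate_other)

lemma syllables_long: "length w < k \<Longrightarrow> syllables a w k = 0"
  by (simp add: syllables_def run_count_long)

text \<open>The product of the conjugates \<open>a\<^bsup>-c\<^sub>i\<^esup> u a\<^bsup>c\<^sub>i\<^esup>\<close> for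
  \<open>i = 1, \<dots>, N\<close>, written in reduced form and without its last block
  \<open>a\<^bsup>c\<^sub>N\<^esup>\<close>. The height is \<open>c\<^sub>N\<close>, with differences
  \<open>c\<^sub>i - c\<^sub>i\<^sub>-\<^sub>1 = length u + i\<close>; they are distinct, and too large to be the
  length of a block inside \<open>u\<close>.\<close>

fun staircase :: "'v letter \<Rightarrow> 'v word \<Rightarrow> nat \<Rightarrow> 'v word" where
  "staircase a u 0 = []"
| "staircase a u (Suc i) = staircase a u i @ replicate (length u + Suc i) (inv_letter a) @ u"

definition staircase_height :: "'v word \<Rightarrow> nat \<Rightarrow> nat" where
  "staircase_height u N = (\<Sum>i<N. length u + Suc i)"

context
  fixes u :: "'v word" and a :: "'v letter"
  assumes u: "u \<noteq> []" "reduced u" "fst (hd u) \<noteq> fst a" "fst (last u) \<noteq> fst a"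
begin

lemma last_staircase: "staircase a u N = [] \<or> fst (last (staircase a u N)) \<noteq> fst a"
  using u by (cases N) auto

lemma reduced_replicate_append: "reduced (replicate m (inv_letter a) @ u)"
  using u by (auto simp: reduced_append_iff reduced_replicate)

lemma reduced_staircase: "reduced (staircase a u N @ replicate m a)"
  "reduced (staircase a u N @ replicate (Suc m) (inv_letter a) @ u)"
proof (induction N arbitrary: m)
  case 0
  have *: "hd u \<noteq> a" using u by auto
  case 1 show ?case by (simp add: reduced_replicate)
  case 2 show ?case using reduced_replicate_append[of "Suc m"] by simp
next
  case (Suc N)
  have *: "hd u \<noteq> a" "a \<noteq> inv_letter (last u)" "a \<noteq> last u" "inv_letter a \<noteq> last u"
    using u by (auto, metis fst_inv_letter)
  have red: "reduced (staircase a u (Suc N))"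
    using Suc(2)[of "length u + N"] by simp
  have last: "staircase a u (Suc N) \<noteq> []" "last (staircase a u (Suc N)) = last u"
    using u(1) by simp_all
  case 1 show ?case
    using red last * by (auto simp: reduced_append_iff reduced_replicate simp del: staircase.simps)
  case 2 show ?case
    using red last * reduced_replicate_append[of "Suc m"]
    by (simp add: reduced_append_iff[of "staircase a u (Suc N)"] del: staircase.simps)
qed

lemma syllables_staircase:
  assumes "length u < k"
  shows "syllables a (staircase a u N) k = - of_bool (k \<le> length u + N)"
proof (induction N)
  case 0
  then show ?case using assms by simp
next
  case (Suc N)
  have "syllables a (staircase a u (Suc N)) k = syllables a (staircase a u N) k +
      (syllables a (replicate (length u + Suc N) (inv_letter a)) k + syllables a u k)"
    using assms u last_staircase[of N]
    by (simp add: syllables_append_last syllables_append_hd del: replicate_Suc)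
  then show ?case
    using assms Suc by (auto simp: syllables_replicate syllables_long simp del: replicate_Suc)
qed

text \<open>The staircase has one block of each length \<open>length u + i\<close> for the inverse of \<open>a\<close>, so
  \<open>\<delta>\<close> is \<open>-1\<close> there. The only other long block is the final one, whose length has to be
  excluded because it could coincide with one of these.\<close>

lemma card_syllable_support_staircase:
  assumes d: "\<not> d dvd 1"
    and B: "finite B"
      "syllable_support d a (staircase a u N @ replicate (staircase_height u N) a) \<subseteq> B"
  shows "N \<le> card B + 1"
proof -
  have "k \<in> B" if "k \<in> {length u + 1..length u + N}" "k \<noteq> staircase_height u N" for k
  proof -
    have "syllables a (staircase a u N @ replicate (staircase_height u N) a) k = - 1"
      using that last_staircase[of N]
      by (simp add: syllables_append_last syllables_staircase syllables_replicate)
    with B(2) d show ?thesis by (auto simp: syllable_support_def)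
  qed
  then have "{length u + 1..length u + N} - {staircase_height u N} \<subseteq> B" by blast
  from card_mono[OF B(1) this] show ?thesis
    by (simp add: card_Diff_singleton_if split: if_splits)
qed

text \<open>By induction: the element for \<open>Suc N\<close> arises from that for \<open>N\<close> by inserting a conjugate
  of \<open>u\<close> in front of the final block, and inserting an element of a normal subgroup inside a
  product does not change membership in that subgroup.\<close>

lemma staircase_in_normal:
  assumes N: "H \<lhd> free_group S" and H: "u \<in> H" and a: "fst a \<in> S"
  shows "staircase a u N @ replicate (staircase_height u N) a \<in> H"
proof -
  interpret H: normal H "free_group S" by (rule N)
  have uS: "fst ` set u \<subseteq> S" using H.mem_carrier[OF H] by (simp add: carrier_free_group)
  have rep: "replicate m a \<in> carrier (free_group S)" for m
    using a by (auto simp: carrier_free_group reduced_replicate)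
  have stS: "fst ` set (staircase a u i) \<subseteq> S" for i
    using uS a by (induction i) auto
  have st: "staircase a u i \<in> carrier (free_group S)" for i
    using reduced_staircase(1)[of i 0] stS by (simp add: carrier_free_group)
  have inv_rep: "inv\<^bsub>free_group S\<^esub> (replicate m a) = replicate m (inv_letter a)" for m
    using rep by (simp add: inv_free_group inv_word_def)
  have "staircase a u N \<otimes>\<^bsub>free_group S\<^esub> replicate (staircase_height u N) a \<in> H"
  proof (induction N)
    case 0
    then show ?case
      using subgroup.one_closed[OF H.subgroup_axioms]
      by (simp add: staircase_height_def mult_free_group one_free_group reduce_word_def)
  next
    case (Suc N)
    define m where "m = length u + Suc N"
    let ?A = "staircase a u N" and ?X = "replicate m a" and ?Y = "replicate (staircase_height u N) a"
    let ?h = "inv\<^bsub>free_group S\<^esub> ?X \<otimes>\<^bsub>free_group S\<^esub> u \<otimes>\<^bsub>free_group S\<^esub> ?X"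
    have uc: "u \<in> carrier (free_group S)" using H.mem_carrier[OF H] .
    have hH: "?h \<in> H" using H.inv_op_closed1[OF rep H] by simp
    have red: "reduced (?A @ replicate m (inv_letter a) @ u)"
      using reduced_staircase(2)[of N "length u + N"] by (simp add: m_def)
    then have "reduced (replicate m (inv_letter a) @ u)" by (simp add: reduced_append_iff)
    with red have "staircase a u (Suc N) =
        ?A \<otimes>\<^bsub>free_group S\<^esub> (inv\<^bsub>free_group S\<^esub> ?X \<otimes>\<^bsub>free_group S\<^esub> u)"
      by (simp add: inv_rep mult_free_group_reduced m_def del: replicate_Suc)
    moreover have "replicate (staircase_height u (Suc N)) a = ?X \<otimes>\<^bsub>free_group S\<^esub> ?Y"
      by (simp add: mult_free_group_reduced reduced_replicate replicate_add[symmetric]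
          staircase_height_def m_def add_ac del: replicate_Suc)
    ultimately have "staircase a u (Suc N) \<otimes>\<^bsub>free_group S\<^esub> replicate (staircase_height u (Suc N)) a =
        ?A \<otimes>\<^bsub>free_group S\<^esub> (?h \<otimes>\<^bsub>free_group S\<^esub> ?Y)"
      using st rep uc by (simp add: H.m_assoc)
    also have "\<dots> = (?A \<otimes>\<^bsub>free_group S\<^esub> ?h \<otimes>\<^bsub>free_group S\<^esub> inv\<^bsub>free_group S\<^esub> ?A)
        \<otimes>\<^bsub>free_group S\<^esub> (?A \<otimes>\<^bsub>free_group S\<^esub> ?Y)"
    proof -
      have "inv\<^bsub>free_group S\<^esub> ?A \<otimes>\<^bsub>free_group S\<^esub> (?A \<otimes>\<^bsub>free_group S\<^esub> ?Y) = ?Y"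
        using st rep by (simp add: H.m_assoc[symmetric])
      then show ?thesis using st rep uc by (simp add: H.m_assoc)
    qed
    also have "\<dots> \<in> H"
      using H.inv_op_closed2[OF st hH] Suc by (rule subgroup.m_closed[OF H.subgroup_axioms])
    finally show ?case .
  qed
  then show ?thesis using mult_free_group_reduced[OF reduced_staircase(1)] by metis
qed

end


section \<open>Verbal subgroups of free groups\<close>

text \<open>If a nontrivial element begins or ends with \<open>x\<close> or its inverse, conjugate it by \<open>y\<close> or its
  inverse; one of the two choices cancels at neither end.\<close>

lemma normal_free_group_nontrivial_ends:
  assumes N: "H \<lhd> free_group S" "H \<noteq> {\<one>\<^bsub>free_group S\<^esub>}" and y: "y \<in> S" "y \<noteq> x"
  obtains u where "u \<in> H" "u \<noteq> []" "fst (hd u) \<noteq> x" "fst (last u) \<noteq> x"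
proof -
  interpret H: normal H "free_group S" by (rule N)
  obtain v where v: "v \<in> H" "v \<noteq> []"
    using N(2) subgroup.one_closed[OF H.subgroup_axioms] by (auto simp: one_free_group)
  show ?thesis
  proof (cases "fst (hd v) \<noteq> x \<and> fst (last v) \<noteq> x")
    case True
    with v that show ?thesis by blast
  next
    case False
    \<comment> \<open>conjugation by \<open>m\<close> cancels at neither end of \<open>v\<close>\<close>
    obtain m where m: "fst m = y" "m \<noteq> inv_letter (hd v)" "m \<noteq> last v"
    proof (cases "fst (hd v) = x")
      case True
      show ?thesis
      proof (rule that[of "(y, \<not> snd (last v))"])
        show "(y, \<not> snd (last v)) \<noteq> inv_letter (hd v)"
          using True y(2) by (auto simp: inv_letter_def)
      qed (auto simp: prod_eq_iff)
    next
      case F: False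
      show ?thesis
      proof (rule that[of "(y, snd (hd v))"])
        show "(y, snd (hd v)) \<noteq> last v"
          using False F y(2) by (metis fst_conv)
      qed (auto simp: inv_letter_def)
    qed
    have mc: "[m] \<in> carrier (free_group S)" using m y by (simp add: carrier_free_group)
    have rv: "reduced v" using H.mem_carrier[OF v(1)] by (simp add: carrier_free_group)
    have hv: "hd v \<noteq> inv_letter m" using m(2) by auto
    have "reduced ([m] @ v)" "reduced (([m] @ v) @ [inv_letter m])"
      using rv v(2) hv m(3) by (auto simp: reduced_Cons_iff reduced_append_iff)
    then have "[m] \<otimes>\<^bsub>free_group S\<^esub> v \<otimes>\<^bsub>free_group S\<^esub> inv\<^bsub>free_group S\<^esub> [m] = [m] @ v @ [inv_letter m]"
      using mc by (simp add: inv_free_group mult_free_group_reduced)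
    then have "[m] @ v @ [inv_letter m] \<in> H"
      using H.inv_op_closed2[OF mc v(1)] by metis
    with that[of "[m] @ v @ [inv_letter m]"] m(1) y(2) show ?thesis by simp
  qed
qed

lemma int_subgroup_principal:
  fixes J :: "int set"
  assumes "0 \<in> J" and diff: "\<And>a b. a \<in> J \<Longrightarrow> b \<in> J \<Longrightarrow> a - b \<in> J"
  obtains d where "d \<in> J" "\<And>e. e \<in> J \<Longrightarrow> d dvd e"
proof (cases "\<exists>n::nat. n > 0 \<and> int n \<in> J")
  case False
  have "e = 0" if "e \<in> J" for e
  proof (rule ccontr)
    assume "e \<noteq> 0"
    then have "nat \<bar>e\<bar> > 0" by simp
    moreover have "int (nat \<bar>e\<bar>) \<in> J" using that diff[OF assms(1) that] by (cases "e \<ge> 0") auto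
    ultimately show False using False by blast
  qed
  with assms(1) that[of 0] show ?thesis by auto
next
  case True
  define n where "n = (LEAST n::nat. n > 0 \<and> int n \<in> J)"
  have n: "n > 0" "int n \<in> J" using LeastI_ex[OF True] by (simp_all add: n_def)
  have neg: "- b \<in> J" if "b \<in> J" for b using diff[OF assms(1) that] by simp
  have mult: "int q * int n \<in> J" for q
  proof (induction q)
    case (Suc q)
    then show ?case using diff[OF Suc neg[OF n(2)]] by (simp add: algebra_simps)
  qed (simp add: assms(1))
  have mult': "q * int n \<in> J" for q
    using mult[of "nat \<bar>q\<bar>"] neg[OF mult[of "nat \<bar>q\<bar>"]] by (cases "q \<ge> 0") auto
  have "int n dvd e" if "e \<in> J" for e
  proof (rule ccontr)
    assume "\<not> int n dvd e"
    then have "e mod int n \<noteq> 0" by auto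
    moreover have "e mod int n \<ge> 0" "e mod int n < int n" using n(1) by simp_all
    moreover have "e mod int n \<in> J"
      using diff[OF that mult'[of "e div int n"]] by (simp add: minus_div_mult_eq_mod)
    ultimately have "nat (e mod int n) > 0 \<and> int (nat (e mod int n)) \<in> J" "nat (e mod int n) < n"
      by auto
    then show False using not_less_Least[of "nat (e mod int n)"] unfolding n_def by blast
  qed
  with n(2) that show ?thesis by blast
qed

text \<open>The integers \<open>e\<close> such that every \<open>e\<close>-th power lies in the verbal subgroup form a
  subgroup of the integers, generated by some \<open>d\<close>. It contains all exponent sums, and it
  contains \<open>1\<close> only if the verbal subgroup is everything.\<close>

lemma (in group) verbal_subgroup_exponent_modulus:
  assumes "verbal_subgroup G V \<noteq> carrier G"
  obtains d where "\<not> d dvd (1::int)" "\<And>w x. w \<in> V \<Longrightarrow> d dvd exponent_sum x w"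
proof -
  interpret H: normal "verbal_subgroup G V" G by (rule verbal_subgroup_normal)
  define J where "J = {e::int. \<forall>g\<in>carrier G. g [^] e \<in> verbal_subgroup G V}"
  have J0: "0 \<in> J" using subgroup.one_closed[OF H.subgroup_axioms] by (simp add: J_def)
  have Jdiff: "a - b \<in> J" if "a \<in> J" "b \<in> J" for a b
    using that subgroup.m_closed[OF H.subgroup_axioms] subgroup.m_inv_closed[OF H.subgroup_axioms]
    by (auto simp: J_def int_pow_diff)
  obtain d where d: "d \<in> J" "\<And>e. e \<in> J \<Longrightarrow> d dvd e"
    using int_subgroup_principal[OF J0 Jdiff] by blast
  have "1 \<notin> J"
    using assms H.subset by (auto simp: J_def)
  then have "d \<noteq> 1" "d \<noteq> - 1"
    using d(1) Jdiff[OF J0 d(1)] by auto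
  then have "\<not> d dvd 1" by auto
  moreover have "d dvd exponent_sum x w" if "w \<in> V" for w x
  proof (rule d(2), unfold J_def, intro CollectI ballI)
    fix g assume g: "g \<in> carrier G"
    then show "g [^] exponent_sum x w \<in> verbal_subgroup G V"
      unfolding word_value_single[OF g, symmetric]
      by (intro word_value_in_verbal_subgroup that) simp
  qed
  ultimately show ?thesis by (rule that)
qed

text \<open>If \<open>m\<close> values always sufficed, the support of every element of the verbal subgroup
  would have at most \<open>m * (18 * L + 18)\<close> elements; a staircase with two more steps violates
  this, one of the two making up for the block length that its final block may spoil.\<close>

theorem width_free_group_infinite:
  assumes S: "x \<in> S" "y \<in> S" "x \<noteq> y" and "finite V"
    and proper: "proper_subgroup (verbal_subgroup (free_group S) V) (free_group S)"
  shows "width (free_group S) V = \<infinity>"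
proof (rule ccontr)
  interpret F: group "free_group S" by (rule group_free_group)
  let ?H = "verbal_subgroup (free_group S) V"
  assume "width (free_group S) V \<noteq> \<infinity>"
  then obtain m where m: "\<And>g. g \<in> ?H \<Longrightarrow>
      \<exists>gs. length gs \<le> m \<and> set gs \<subseteq> word_values (free_group S) V \<and> g = group_product (free_group S) gs"
    using width_finiteE by blast
  obtain L where "\<forall>n\<in>length ` V. n \<le> L"
    using finite_nat_set_iff_bounded_le[of "length ` V"] \<open>finite V\<close> by blast
  then have L: "length w \<le> L" if "w \<in> V" for w using that by blast
  have H: "?H \<noteq> carrier (free_group S)" "?H \<noteq> {\<one>\<^bsub>free_group S\<^esub>}"
    using proper by (simp_all add: proper_subgroup_def)
  obtain d where d: "\<not> d dvd (1::int)" "\<And>w x. w \<in> V \<Longrightarrow> d dvd exponent_sum x w"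
    by (rule F.verbal_subgroup_exponent_modulus[OF H(1)], rule that)
  obtain u where u: "u \<in> ?H" "u \<noteq> []" "fst (hd u) \<noteq> x" "fst (last u) \<noteq> x"
    by (rule normal_free_group_nontrivial_ends[OF F.verbal_subgroup_normal H(2) S(2) S(3)[symmetric]])
  have red: "reduced u"
    using subgroup.mem_carrier[OF normal_imp_subgroup[OF F.verbal_subgroup_normal] u(1)]
    by (simp add: carrier_free_group)
  have u': "u \<noteq> []" "reduced u" "fst (hd u) \<noteq> fst (x, True)" "fst (last u) \<noteq> fst (x, True)"
    using u red by simp_all
  \<comment> \<open>\<open>N - 1\<close> exceeds the size of the support of any product of \<open>m\<close> values\<close>
  define N where "N = m * (18 * L + 18) + 2"
  let ?w = "staircase (x, True) u N @ replicate (staircase_height u N) (x, True)"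
  have wH: "?w \<in> ?H"
    using S(1) by (intro staircase_in_normal[OF u' F.verbal_subgroup_normal u(1)]) simp
  obtain gs where gs: "length gs \<le> m" "set gs \<subseteq> word_values (free_group S) V"
    "?w = group_product (free_group S) gs" using m[OF wH] by (elim exE conjE)
  obtain B where B: "finite B" "card B \<le> length gs * (18 * L + 18)"
      "syllable_support d (x, True) (group_product (free_group S) gs) \<subseteq> B"
    using syllable_support_group_product[where a = "(x, True)", OF _ _ gs(2), of L d] L d(2)
    by blast
  have "N \<le> card B + 1"
    by (rule card_syllable_support_staircase[OF u' d(1) B(1) B(3)[folded gs(3)]])
  also have "\<dots> \<le> m * (18 * L + 18) + 1"
    using order_trans[OF B(2) mult_le_mono1[OF gs(1)]] by simp
  finally show False by (simp add: N_def)
qed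


section \<open>Endomorphisms conjugating both generators\<close>

text \<open>Choose the generator \<open>z\<close> that does not occur in the first letter of \<open>c\<close>. Then \<open>z c\<close> is
  reduced, so \<open>c z\<close> has the same length and is reduced too, but it begins with the first letter
  of \<open>c\<close> instead of \<open>z\<close>.\<close>

lemma commutes_with_two_generators:
  assumes "x \<noteq> y" "x \<in> S" "y \<in> S" and c: "c \<in> carrier (free_group S)"
    and comm: "\<And>z. z \<in> {x, y} \<Longrightarrow>
      c \<otimes>\<^bsub>free_group S\<^esub> free_gen z = free_gen z \<otimes>\<^bsub>free_group S\<^esub> c"
  shows "c = []"
proof (rule ccontr)
  assume "c \<noteq> []"
  obtain z where z: "z \<in> {x, y}" "z \<noteq> fst (hd c)" using \<open>x \<noteq> y\<close> by blast
  have rc: "reduced c" using c by (simp add: carrier_free_group)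
  have gen: "free_gen z \<in> carrier (free_group S)" using z assms(2,3) by auto
  have "hd c \<noteq> inv_letter (z, True)" using z(2) by (auto simp: inv_letter_def)
  then have left: "free_gen z \<otimes>\<^bsub>free_group S\<^esub> c = (z, True) # c"
    using rc by (simp add: free_gen_def mult_free_group_reduced reduced_Cons_iff)
  obtain p d q where pq: "c = p @ d" "[(z, True)] = inv_word d @ q"
      "foldr push_letter c [(z, True)] = p @ q"
    using foldr_push_cancel[OF rc, of "[(z, True)]"] by auto
  have "p @ q = (z, True) # c"
    using comm[OF z(1)] left pq(3) mult_free_group_foldr[OF gen, of c] by (simp add: free_gen_def)
  moreover have "length d + length q = 1"
    using arg_cong[OF pq(2), of length] by (simp add: inv_word_def)
  moreover have "length (p @ q) = length p + length q" by simp
  ultimately have "d = []" using pq(1) by (cases "length d") auto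
  with pq \<open>p @ q = (z, True) # c\<close> \<open>c \<noteq> []\<close> have "hd c = (z, True)"
    by (metis append_Nil2 hd_append2 list.sel(1))
  with z(2) show False by simp
qed

text \<open>If \<open>h\<close> begins with a power of \<open>x\<close> and ends with a power of \<open>y\<close>, then \<open>x\<close> and
  \<open>h\<^sup>-\<^sup>1 y h\<close> do not generate the free group. Almost nothing cancels when a reduced word is
  evaluated at them: if its first letter is \<open>l\<close>, then the value begins with \<open>l\<close> or with
  \<open>h\<^sup>-\<^sup>1 l\<close>, depending on the generator in \<open>l\<close>. The word \<open>y\<close> does
  neither, as \<open>h\<close> is not empty.\<close>

context
  fixes x y :: 'v and h :: "'v word"
  assumes xy: "x \<noteq> y"
    and h: "h \<in> carrier (free_group {x, y})" "h \<noteq> []" "fst (hd h) = x" "fst (last h) = y"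
begin

private definition "conj_subst = word_value (free_group {x, y})
  (\<lambda>z. if z = x then [(x, True)] else inv_word h @ [(y, True)] @ h)"

private lemma reduced_conj: "fst l = y \<Longrightarrow> reduced (inv_word h @ [l] @ h)"
  using h xy by (auto simp: reduced_append_iff reduced_inv_word last_inv_word carrier_free_group
      reduced_Cons_iff)

private lemma letter_conj_subst:
  assumes "fst l \<in> {x, y}"
  shows "letter_value (free_group {x, y})
      (\<lambda>z. if z = x then [(x, True)] else inv_word h @ [(y, True)] @ h) l =
    (if fst l = x then [l] else inv_word h @ [l] @ h)"
proof -
  have "inv_word h @ [(y, True)] @ h \<in> carrier (free_group {x, y})"
    using reduced_conj[of "(y, True)"] h(1) by (simp add: carrier_free_group fst_set_inv_word image_Un)
  moreover have "[(x, True)] \<in> carrier (free_group {x, y})" by (simp add: carrier_free_group)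
  ultimately show ?thesis
    using assms xy
    by (cases l; cases "snd l")
       (auto simp: letter_value_def inv_free_group inv_word_append inv_letter_def)
qed

private lemma conj_subst_carrier: "w \<in> carrier (free_group {x, y}) \<Longrightarrow> conj_subst w \<in> carrier (free_group {x, y})"
proof -
  interpret F: group "free_group {x, y}" by (rule group_free_group)
  assume "w \<in> carrier (free_group {x, y})"
  then show ?thesis
    unfolding conj_subst_def using reduced_conj[of "(y, True)"] h(1)
    by (intro F.word_value_closed) (auto simp: carrier_free_group fst_set_inv_word image_Un)
qed

text \<open>Induction on the word, adding letters on the left. Cancellation occurs only between two
  consecutive equal letters \<open>y\<close> or two consecutive equal letters \<open>y\<^sup>-\<^sup>1\<close>, where
  \<open>h h\<^sup>-\<^sup>1\<close> disappears and leaves those two letters next to each other.\<close>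

lemma conjugated_prefix:
  assumes "l # v \<in> carrier (free_group {x, y})"
  shows "\<exists>z. conj_subst (l # v) = (if fst l = x then l # z else inv_word h @ [l] @ z)"
  using assms
proof (induction v arbitrary: l)
  interpret F: group "free_group {x, y}" by (rule group_free_group)
  case Nil
  have "conj_subst [l] = (if fst l = x then [l] else inv_word h @ [l] @ h)"
    using Nil letter_conj_subst[of l] reduced_conj[of l]
    by (auto simp: conj_subst_def carrier_free_group one_free_group mult_free_group_reduced)
  then show ?case by auto
next
  interpret F: group "free_group {x, y}" by (rule group_free_group)
  case (Cons m v)
  let ?V = "if fst l = x then [l] else inv_word h @ [l] @ h"
  have l: "fst l \<in> {x, y}" and m: "fst m \<in> {x, y}" "m \<noteq> inv_letter l"
    and mv: "m # v \<in> carrier (free_group {x, y})"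
    using Cons.prems by (auto simp: carrier_free_group)
  obtain z where z: "conj_subst (m # v) = (if fst m = x then m # z else inv_word h @ [m] @ z)"
    using Cons.IH[OF mv] by blast
  have red: "reduced (conj_subst (m # v))" and Ec: "conj_subst (m # v) \<in> carrier (free_group {x, y})"
    using conj_subst_carrier[OF mv] by (auto simp: carrier_free_group)
  have step: "conj_subst (l # m # v) = ?V \<otimes>\<^bsub>free_group {x, y}\<^esub> conj_subst (m # v)"
    unfolding conj_subst_def using letter_conj_subst[OF l] by simp
  have ih: "inv_word h \<noteq> []" "hd (inv_word h) = inv_letter (last h)" "fst (last h) = y"
    using h by (simp_all add: hd_inv_word)
  show ?case
  proof (cases "fst l = x")
    case True
    have "reduced ([l] @ conj_subst (m # v))"
      using red z True m ih xy by (auto simp: reduced_Cons_iff)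
    then show ?thesis unfolding step using True by (simp add: mult_free_group_reduced)
  next
    case ly: False
    then have l': "fst l = y" using l by simp
    note redl = reduced_conj[OF l']
    show ?thesis
    proof (cases "fst m = x")
      case True
      have "hd (conj_subst (m # v)) \<noteq> inv_letter (last h)"
        using z True h(4) xy by auto
      then have "reduced ((inv_word h @ [l] @ h) @ conj_subst (m # v))"
        using redl red h(2) by (subst reduced_append_iff) simp
      then show ?thesis unfolding step using ly by (simp add: mult_free_group_reduced)
    next
      case False
      then have ml: "m = l" using m l' by (cases m; cases l) (auto simp: inv_letter_def)
      \<comment> \<open>the two copies of \<open>l\<close> survive in \<open>?A\<close> and \<open>?B\<close>, and \<open>h\<close> cancels between them\<close>
      let ?A = "inv_word h @ [l]" and ?B = "[m] @ z"
      have rAh: "reduced (?A @ h)" using redl by simp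
      have rhB: "reduced (inv_word h @ ?B)" using red z False by simp
      have rA: "reduced ?A" and rB: "reduced ?B"
        using rAh rhB unfolding reduced_append_iff[of ?A] reduced_append_iff[of _ ?B] by auto
      have cA: "?A \<in> carrier (free_group {x, y})"
        using rA h(1) l by (auto simp: carrier_free_group fst_set_inv_word image_Un)
      have cB: "?B \<in> carrier (free_group {x, y})"
        using rB Ec z False by (auto simp: carrier_free_group)
      have "conj_subst (l # m # v) = (?A \<otimes>\<^bsub>free_group {x, y}\<^esub> h) \<otimes>\<^bsub>free_group {x, y}\<^esub>
          (inv\<^bsub>free_group {x, y}\<^esub> h \<otimes>\<^bsub>free_group {x, y}\<^esub> ?B)"
        using ly False z by (simp add: step inv_free_group[OF h(1)] mult_free_group_reduced[OF rAh]
            mult_free_group_reduced[OF rhB, simplified])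
      also have "\<dots> = ?A \<otimes>\<^bsub>free_group {x, y}\<^esub>
          (h \<otimes>\<^bsub>free_group {x, y}\<^esub> inv\<^bsub>free_group {x, y}\<^esub> h \<otimes>\<^bsub>free_group {x, y}\<^esub> ?B)"
        using cA cB h(1) by (simp only: F.m_assoc F.m_closed F.inv_closed)
      also have "\<dots> = ?A \<otimes>\<^bsub>free_group {x, y}\<^esub> ?B"
        using cB h(1) by simp
      also have "\<dots> = ?A @ ?B"
        using rA rB ml by (intro mult_free_group_reduced, subst reduced_append_iff) simp
      finally show ?thesis using ly by simp
    qed
  qed
qed

lemma conjugated_not_surj:
  assumes "w \<in> carrier (free_group {x, y})"
  shows "word_value (free_group {x, y})
    (\<lambda>z. if z = x then [(x, True)] else inv_word h @ [(y, True)] @ h) w \<noteq> [(y, True)]"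
proof (cases w)
  interpret F: group "free_group {x, y}" by (rule group_free_group)
  case Nil
  then show ?thesis by (simp add: one_free_group)
next
  case (Cons l v)
  from conjugated_prefix[of l v] assms[unfolded Cons]
  obtain z where "conj_subst w = (if fst l = x then l # z else inv_word h @ [l] @ z)"
    unfolding Cons by blast
  then have "conj_subst w \<noteq> [(y, True)]"
    using xy h(2) by (auto simp: append_eq_Cons_conv)
  then show ?thesis by (simp add: conj_subst_def)
qed

end

lemma homs_free_group_eqI:
  assumes "group G" "f \<in> hom (free_group S) G" "g \<in> hom (free_group S) G"
    and "\<And>x. x \<in> S \<Longrightarrow> f (free_gen x) = g (free_gen x)" and w: "w \<in> carrier (free_group S)"
  shows "f w = g w"
proof -
  have "word_value G (f \<circ> free_gen) w = word_value G (g \<circ> free_gen) w"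
    using w assms(4) by (intro group.word_value_cong[OF assms(1)]) (auto simp: carrier_free_group)
  then show ?thesis
    using hom_free_group_eq_word_value[OF assms(1,2) w]
      hom_free_group_eq_word_value[OF assms(1,3) w] by simp
qed

lemma free_gen_conj_letter:
  assumes "fst l \<in> S"
  shows "inv\<^bsub>free_group S\<^esub> [l] \<otimes>\<^bsub>free_group S\<^esub> free_gen (fst l) \<otimes>\<^bsub>free_group S\<^esub> [l] = free_gen (fst l)"
proof -
  interpret F: group "free_group S" by (rule group_free_group)
  have c: "free_gen (fst l) \<in> carrier (free_group S)" using assms by simp
  show ?thesis
  proof (cases "snd l")
    case True
    then have "[l] = free_gen (fst l)" by (cases l) (simp add: free_gen_def)
    with c show ?thesis by simp
  next
    case False
    then have "[l] = inv\<^bsub>free_group S\<^esub> (free_gen (fst l))"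
      using assms by (cases l) (simp add: inv_free_gen)
    with c show ?thesis by (simp add: F.m_assoc)
  qed
qed

text \<open>Up to an inner automorphism (conjugation by \<open>c\<close>), the endomorphism fixes \<open>x\<close> and sends \<open>y\<close>
  to \<open>h\<^sup>-\<^sup>1 y h\<close>. Among all such descriptions take one with \<open>h\<close> shortest. A first letter
  \<open>y\<close> or \<open>y\<^sup>-\<^sup>1\<close> of \<open>h\<close> could be dropped, and a last letter \<open>x\<close> or
  \<open>x\<^sup>-\<^sup>1\<close> could be moved into \<open>c\<close>, so a nonempty \<open>h\<close> would begin with a power
  of \<open>x\<close> and end with a power of \<open>y\<close>, which contradicts surjectivity.\<close>

lemma surj_conjugating_endo_inner:
  fixes x y :: 'v
  defines "F \<equiv> free_group {x, y}"
  assumes xy: "x \<noteq> y"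
    and hom: "\<theta> \<in> hom F F" and surj: "carrier F \<subseteq> \<theta> ` carrier F"
    and f: "f \<in> carrier F" "\<theta> (free_gen x) = inv\<^bsub>F\<^esub> f \<otimes>\<^bsub>F\<^esub> free_gen x \<otimes>\<^bsub>F\<^esub> f"
    and g: "g \<in> carrier F" "\<theta> (free_gen y) = inv\<^bsub>F\<^esub> g \<otimes>\<^bsub>F\<^esub> free_gen y \<otimes>\<^bsub>F\<^esub> g"
  shows "\<exists>c\<in>carrier F. \<forall>w\<in>carrier F. \<theta> w = inv\<^bsub>F\<^esub> c \<otimes>\<^bsub>F\<^esub> w \<otimes>\<^bsub>F\<^esub> c"
proof -
  interpret F: group F unfolding F_def by (rule group_free_group)
  interpret \<theta>: group_hom F F \<theta> using hom by unfold_locales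
  have gen: "free_gen x \<in> carrier F" "free_gen y \<in> carrier F" by (simp_all add: F_def)
  define P where "P = (\<lambda>(h, c). h \<in> carrier F \<and> c \<in> carrier F \<and>
    \<theta> (free_gen x) = inv\<^bsub>F\<^esub> c \<otimes>\<^bsub>F\<^esub> free_gen x \<otimes>\<^bsub>F\<^esub> c \<and>
    \<theta> (free_gen y) = inv\<^bsub>F\<^esub> (h \<otimes>\<^bsub>F\<^esub> c) \<otimes>\<^bsub>F\<^esub> free_gen y \<otimes>\<^bsub>F\<^esub> (h \<otimes>\<^bsub>F\<^esub> c))"
  have "g \<otimes>\<^bsub>F\<^esub> inv\<^bsub>F\<^esub> f \<otimes>\<^bsub>F\<^esub> f = g" using f(1) g(1) by (simp add: F.m_assoc)
  then have "P (g \<otimes>\<^bsub>F\<^esub> inv\<^bsub>F\<^esub> f, f)" using f g by (simp add: P_def)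
  from ex_has_least_nat[of P, OF this, of "\<lambda>(h, c). length h"]
  obtain h c where hc: "P (h, c)" and min: "\<And>h' c'. P (h', c') \<Longrightarrow> length h \<le> length h'"
    by auto
  have h: "h \<in> carrier F" and c: "c \<in> carrier F"
    and \<theta>x: "\<theta> (free_gen x) = inv\<^bsub>F\<^esub> c \<otimes>\<^bsub>F\<^esub> free_gen x \<otimes>\<^bsub>F\<^esub> c"
    and \<theta>y: "\<theta> (free_gen y) = inv\<^bsub>F\<^esub> (h \<otimes>\<^bsub>F\<^esub> c) \<otimes>\<^bsub>F\<^esub> free_gen y \<otimes>\<^bsub>F\<^esub> (h \<otimes>\<^bsub>F\<^esub> c)"
    using hc by (simp_all add: P_def)
  have conj_mult: "inv\<^bsub>F\<^esub> (a \<otimes>\<^bsub>F\<^esub> b) \<otimes>\<^bsub>F\<^esub> k \<otimes>\<^bsub>F\<^esub> (a \<otimes>\<^bsub>F\<^esub> b) =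
      inv\<^bsub>F\<^esub> b \<otimes>\<^bsub>F\<^esub> (inv\<^bsub>F\<^esub> a \<otimes>\<^bsub>F\<^esub> k \<otimes>\<^bsub>F\<^esub> a) \<otimes>\<^bsub>F\<^esub> b"
    if "a \<in> carrier F" "b \<in> carrier F" "k \<in> carrier F" for a b k
    using that by (simp add: F.inv_mult_group F.m_assoc)
  have "h = []"
  proof (rule ccontr)
    assume "h \<noteq> []"
    have hS: "reduced h" "fst ` set h \<subseteq> {x, y}" using h by (simp_all add: F_def carrier_free_group)
    have "fst (hd h) \<noteq> y"
    proof
      assume y: "fst (hd h) = y"
      obtain l h' where lh: "h = l # h'" using \<open>h \<noteq> []\<close> by (cases h) auto
      have l: "[l] \<in> carrier F" and h': "h' \<in> carrier F" and fl: "fst l = y"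
        using hS y by (auto simp: lh F_def carrier_free_group reduced_Cons_iff)
      have "h = [l] \<otimes>\<^bsub>F\<^esub> h'" using hS(1) by (simp add: lh F_def mult_free_group_reduced)
      then have "h \<otimes>\<^bsub>F\<^esub> c = [l] \<otimes>\<^bsub>F\<^esub> (h' \<otimes>\<^bsub>F\<^esub> c)" using l h' c by (simp add: F.m_assoc)
      moreover have "inv\<^bsub>F\<^esub> [l] \<otimes>\<^bsub>F\<^esub> free_gen y \<otimes>\<^bsub>F\<^esub> [l] = free_gen y"
        using free_gen_conj_letter[of l "{x, y}"] fl by (simp add: F_def)
      ultimately have "P (h', c)"
        using \<theta>x \<theta>y h' c l gen conj_mult[of "[l]" "h' \<otimes>\<^bsub>F\<^esub> c" "free_gen y"] by (simp add: P_def)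
      from min[OF this] show False by (simp add: lh)
    qed
    then have hd: "fst (hd h) = x" using hS(2) \<open>h \<noteq> []\<close> by (cases h) auto
    have "fst (last h) \<noteq> x"
    proof
      assume x: "fst (last h) = x"
      obtain l h' where lh: "h = h' @ [l]" using \<open>h \<noteq> []\<close> by (cases h rule: rev_cases) auto
      have l: "[l] \<in> carrier F" and h': "h' \<in> carrier F" and fl: "fst l = x"
        using hS x by (auto simp: lh F_def carrier_free_group reduced_append_iff)
      have "h = h' \<otimes>\<^bsub>F\<^esub> [l]" using hS(1) by (simp add: lh F_def mult_free_group_reduced)
      then have "h \<otimes>\<^bsub>F\<^esub> c = h' \<otimes>\<^bsub>F\<^esub> ([l] \<otimes>\<^bsub>F\<^esub> c)" using l h' c by (simp add: F.m_assoc)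
      moreover have "inv\<^bsub>F\<^esub> [l] \<otimes>\<^bsub>F\<^esub> free_gen x \<otimes>\<^bsub>F\<^esub> [l] = free_gen x"
        using free_gen_conj_letter[of l "{x, y}"] fl by (simp add: F_def)
      ultimately have "P (h', [l] \<otimes>\<^bsub>F\<^esub> c)"
        using \<theta>x \<theta>y h' c l gen conj_mult[of "[l]" c "free_gen x"] by (simp add: P_def)
      from min[OF this] show False by (simp add: lh)
    qed
    then have last: "fst (last h) = y" using hS(2) \<open>h \<noteq> []\<close> by (cases h rule: rev_cases) auto
    note hyps = xy h[unfolded F_def] \<open>h \<noteq> []\<close> hd last
    \<comment> \<open>\<open>\<psi>\<close> is \<open>\<theta>\<close> with the conjugation by \<open>c\<close> undone\<close>
    define \<psi> where "\<psi> = (\<lambda>w. c \<otimes>\<^bsub>F\<^esub> \<theta> w \<otimes>\<^bsub>F\<^esub> inv\<^bsub>F\<^esub> c)"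
    interpret c: group_hom F F "\<lambda>w. c \<otimes>\<^bsub>F\<^esub> w \<otimes>\<^bsub>F\<^esub> inv\<^bsub>F\<^esub> c" by (rule F.inner_hom[OF c])
    have \<psi>: "\<psi> \<in> hom F F"
      using hom_compose[OF hom c.homh] by (simp add: \<psi>_def comp_def)
    have cancel: "c \<otimes>\<^bsub>F\<^esub> (inv\<^bsub>F\<^esub> c \<otimes>\<^bsub>F\<^esub> k \<otimes>\<^bsub>F\<^esub> c) \<otimes>\<^bsub>F\<^esub> inv\<^bsub>F\<^esub> c = k" if "k \<in> carrier F" for k
    proof -
      have "c \<otimes>\<^bsub>F\<^esub> (inv\<^bsub>F\<^esub> c \<otimes>\<^bsub>F\<^esub> k) = k"
        using that c by (simp add: F.m_assoc[symmetric])
      then show ?thesis using that c by (simp add: F.m_assoc)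
    qed
    have \<psi>x: "\<psi> (free_gen x) = [(x, True)]"
      unfolding \<psi>_def \<theta>x cancel[OF gen(1)] by (simp add: free_gen_def)
    have "hd h \<noteq> inv_letter (y, True)" "inv_letter (hd h) \<noteq> inv_letter (y, True)"
      using hd xy by (auto simp: inv_letter_def prod_eq_iff)
    then have red: "reduced (inv_word h @ free_gen y @ h)" "reduced (free_gen y @ h)"
      using hyps hS(1) by (auto simp: free_gen_def reduced_append_iff reduced_Cons_iff
          reduced_inv_word last_inv_word)
    have "\<psi> (free_gen y) = inv\<^bsub>F\<^esub> h \<otimes>\<^bsub>F\<^esub> free_gen y \<otimes>\<^bsub>F\<^esub> h"
      unfolding \<psi>_def \<theta>y conj_mult[OF h c gen(2)] using h gen(2) by (intro cancel) simp
    also have "\<dots> = inv_word h @ [(y, True)] @ h"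
      using red h gen by (simp add: F.m_assoc)
        (simp add: F_def inv_free_group mult_free_group_reduced free_gen_def)
    finally have \<psi>y: "\<psi> (free_gen y) = inv_word h @ [(y, True)] @ h" .
    have "inv\<^bsub>F\<^esub> c \<otimes>\<^bsub>F\<^esub> free_gen y \<otimes>\<^bsub>F\<^esub> c \<in> carrier F" using c gen by simp
    then have "inv\<^bsub>F\<^esub> c \<otimes>\<^bsub>F\<^esub> free_gen y \<otimes>\<^bsub>F\<^esub> c \<in> \<theta> ` carrier F"
      by (rule subsetD[OF surj])
    then obtain w where w: "inv\<^bsub>F\<^esub> c \<otimes>\<^bsub>F\<^esub> free_gen y \<otimes>\<^bsub>F\<^esub> c = \<theta> w" "w \<in> carrier F"
      by (rule imageE)
    have "\<psi> w = [(y, True)]" unfolding \<psi>_def w(1)[symmetric] cancel[OF gen(2)] by (simp add: free_gen_def)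
    moreover have "\<psi> w = word_value F (\<psi> \<circ> free_gen) w"
      using hom_free_group_eq_word_value[of F \<psi> "{x, y}" w] \<psi> w(2) F.group_axioms by (simp add: F_def)
    moreover have "word_value F (\<psi> \<circ> free_gen) w = word_value F
        (\<lambda>z. if z = x then [(x, True)] else inv_word h @ [(y, True)] @ h) w"
    proof (rule F.word_value_cong)
      fix z assume "z \<in> fst ` set w"
      then have "z = x \<or> z = y" using w(2) by (auto simp: F_def carrier_free_group)
      then show "(\<psi> \<circ> free_gen) z = (if z = x then [(x, True)] else inv_word h @ [(y, True)] @ h)"
        using \<psi>x \<psi>y by auto
    qed
    ultimately have "word_value F
        (\<lambda>z. if z = x then [(x, True)] else inv_word h @ [(y, True)] @ h) w = [(y, True)]"
      by metis
    then show False
      unfolding F_def by (rule notE[OF conjugated_not_surj[OF hyps w(2)[unfolded F_def]]])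
  qed
  have one: "[] = \<one>\<^bsub>F\<^esub>" by (simp add: F_def one_free_group)
  have \<theta>y': "\<theta> (free_gen y) = inv\<^bsub>F\<^esub> c \<otimes>\<^bsub>F\<^esub> free_gen y \<otimes>\<^bsub>F\<^esub> c"
    using \<theta>y c unfolding \<open>h = []\<close> one by simp
  interpret c: group_hom F F "\<lambda>w. inv\<^bsub>F\<^esub> c \<otimes>\<^bsub>F\<^esub> w \<otimes>\<^bsub>F\<^esub> inv\<^bsub>F\<^esub> (inv\<^bsub>F\<^esub> c)"
    using c by (intro F.inner_hom) simp
  have "\<theta> w = inv\<^bsub>F\<^esub> c \<otimes>\<^bsub>F\<^esub> w \<otimes>\<^bsub>F\<^esub> inv\<^bsub>F\<^esub> (inv\<^bsub>F\<^esub> c)" if w: "w \<in> carrier F" for w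
  proof (rule homs_free_group_eqI[where S = "{x, y}" and G = F and f = \<theta> and
        g = "\<lambda>w. inv\<^bsub>F\<^esub> c \<otimes>\<^bsub>F\<^esub> w \<otimes>\<^bsub>F\<^esub> inv\<^bsub>F\<^esub> (inv\<^bsub>F\<^esub> c)"])
    show "\<theta> \<in> hom (free_group {x, y}) F" using hom by (simp add: F_def)
    show "(\<lambda>w. inv\<^bsub>F\<^esub> c \<otimes>\<^bsub>F\<^esub> w \<otimes>\<^bsub>F\<^esub> inv\<^bsub>F\<^esub> (inv\<^bsub>F\<^esub> c)) \<in> hom (free_group {x, y}) F"
      using c.homh by (simp only: F_def)
  qed (use c \<theta>x \<theta>y' w F.group_axioms in \<open>auto simp: F_def\<close>)
  with c show ?thesis by (intro bexI[of _ c]) auto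
qed


section \<open>From basis-conjugating automorphisms to the free group of rank 2\<close>

lemma group_Fn: "group (Fn n)"
  unfolding Fn_def by (rule group_free_group)

lemma carrier_Fn_mono: "m \<le> n \<Longrightarrow> carrier (Fn m) \<subseteq> carrier (Fn n)"
  by (force simp: Fn_def carrier_free_group)

text \<open>For \<open>m \<le> n\<close> this is the homomorphism from \<open>F\<^sub>n\<close> onto \<open>F\<^sub>m\<close> that kills
  the generators beyond the \<open>m\<close>-th.\<close>

definition retraction :: "nat \<Rightarrow> nat word \<Rightarrow> nat word" where
  "retraction m = word_value (Fn m) (\<lambda>i. if i \<in> {1..m} then free_gen i else [])"

lemma retraction_gens: "(if i \<in> {1..m} then free_gen i else []) \<in> carrier (Fn m)"
  by (simp add: Fn_def carrier_free_group[of "[]"])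

lemma retraction_hom: "retraction m \<in> hom (Fn n) (Fn m)"
  unfolding retraction_def Fn_def[of n]
  by (rule group.word_value_hom[OF group_Fn retraction_gens])

lemma retraction_free_gen:
  "retraction m (free_gen i) = (if i \<in> {1..m} then free_gen i else [])"
proof -
  interpret F: group "Fn m" by (rule group_Fn)
  have "word_value (Fn m) \<sigma> (free_gen i) = \<sigma> i \<otimes>\<^bsub>Fn m\<^esub> \<one>\<^bsub>Fn m\<^esub>" for \<sigma>
    by (simp add: free_gen_def letter_value_def)
  then show ?thesis
    unfolding retraction_def by (simp only: F.r_one[OF retraction_gens])
qed

lemma retraction_id:
  assumes "w \<in> carrier (Fn m)"
  shows "retraction m w = w"
proof -
  interpret F: group "Fn m" by (rule group_Fn)
  have "retraction m w = word_value (Fn m) free_gen w"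
    unfolding retraction_def using assms
    by (intro F.word_value_cong) (auto simp: Fn_def carrier_free_group)
  then show ?thesis
    using assms by (simp add: Fn_def word_value_free_gen carrier_free_group reduce_word_reduced)
qed

lemma mult_Cb:
  "\<phi> \<in> carrier (Cb n) \<Longrightarrow> \<psi> \<in> carrier (Cb n) \<Longrightarrow> \<phi> \<otimes>\<^bsub>Cb n\<^esub> \<psi> = compose (carrier (Fn n)) \<phi> \<psi>"
  by (simp add: Cb_def basis_conj_auto_def AutoGroup_def BijGroup_def auto_def)

lemma carrier_Cb: "carrier (Cb n) = basis_conj_auto n"
  by (simp add: Cb_def)

context
  fixes n :: nat
  assumes n: "n \<ge> 2"
begin

lemma carrier_F2_subset: "carrier (Fn 2) \<subseteq> carrier (Fn n)"
  using n by (rule carrier_Fn_mono)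

text \<open>Conjugates of the killed generators are killed, so \<open>\<phi>\<close> induces an endomorphism \<open>\<theta>\<close> of
  \<open>F\<^sub>2\<close>. It is surjective because \<open>\<phi>\<close> is, and conjugates both generators.\<close>

lemma retraction_Cb_inner:
  assumes \<phi>: "\<phi> \<in> carrier (Cb n)"
  shows "\<exists>c\<in>carrier (Fn 2). \<forall>w\<in>carrier (Fn n).
    retraction 2 (\<phi> w) = c \<otimes>\<^bsub>Fn 2\<^esub> retraction 2 w \<otimes>\<^bsub>Fn 2\<^esub> inv\<^bsub>Fn 2\<^esub> c"
proof -
  interpret G: group "Fn n" by (rule group_Fn)
  interpret F: group "Fn 2" by (rule group_Fn)
  let ?r = "retraction 2"
  interpret r: group_hom "Fn n" "Fn 2" ?r
    by unfold_locales (rule retraction_hom)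
  have \<phi>h: "\<phi> \<in> hom (Fn n) (Fn n)" and \<phi>b: "bij_betw \<phi> (carrier (Fn n)) (carrier (Fn n))"
    using \<phi> by (auto simp: carrier_Cb basis_conj_auto_def auto_def Bij_def)
  interpret \<phi>: group_hom "Fn n" "Fn n" \<phi> using \<phi>h by unfold_locales
  have gen: "free_gen i \<in> carrier (Fn n)" if "i \<in> {1..n}" for i
    using that by (simp add: Fn_def)
  have conj: "\<exists>f\<in>carrier (Fn 2). ?r (\<phi> (free_gen i)) =
      inv\<^bsub>Fn 2\<^esub> f \<otimes>\<^bsub>Fn 2\<^esub> ?r (free_gen i) \<otimes>\<^bsub>Fn 2\<^esub> f" if i: "i \<in> {1..n}" for i
  proof -
    obtain f where "f \<in> carrier (Fn n)"
      "\<phi> (free_gen i) = inv\<^bsub>Fn n\<^esub> f \<otimes>\<^bsub>Fn n\<^esub> free_gen i \<otimes>\<^bsub>Fn n\<^esub> f"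
      using \<phi> i unfolding carrier_Cb basis_conj_auto_def by blast
    with gen[OF i] show ?thesis by (intro bexI[of _ "?r f"]) simp_all
  qed
  define \<tau> where "\<tau> = (\<lambda>i. if i \<in> {1..n} then ?r (\<phi> (free_gen i)) else \<one>\<^bsub>Fn 2\<^esub>)"
  define \<theta> where "\<theta> = word_value (Fn 2) \<tau>"
  have \<tau>: "\<tau> i \<in> carrier (Fn 2)" for i using gen by (simp add: \<tau>_def)
  have \<theta>h: "\<theta> \<in> hom (Fn 2) (Fn 2)"
    unfolding \<theta>_def using F.word_value_hom[of "{1..2}" \<tau>] \<tau> by (simp add: Fn_def)
  interpret \<theta>: group_hom "Fn 2" "Fn 2" \<theta> using \<theta>h by unfold_locales
  have \<theta>gen: "\<theta> (free_gen i) = \<tau> i" for i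
    using \<tau> by (simp add: \<theta>_def free_gen_def letter_value_def)
  have factor: "?r (\<phi> w) = \<theta> (?r w)" if w: "w \<in> carrier (Fn n)" for w
  proof -
    have "(?r \<circ> \<phi>) w = (\<theta> \<circ> ?r) w"
    proof (rule homs_free_group_eqI[where S = "{1..n}" and G = "Fn 2" and
        f = "?r \<circ> \<phi>" and g = "\<theta> \<circ> ?r"])
      show "?r \<circ> \<phi> \<in> hom (free_group {1..n}) (Fn 2)"
        using hom_compose[OF \<phi>h r.homh] by (simp add: Fn_def)
      show "\<theta> \<circ> ?r \<in> hom (free_group {1..n}) (Fn 2)"
        using hom_compose[OF r.homh \<theta>h] by (simp add: Fn_def)
    next
      fix i assume i: "i \<in> {1..n}"
      show "(?r \<circ> \<phi>) (free_gen i) = (\<theta> \<circ> ?r) (free_gen i)"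
      proof (cases "i \<in> {1..2}")
        case True
        with i show ?thesis by (simp add: retraction_free_gen \<theta>gen \<tau>_def)
      next
        case False
        then have r1: "?r (free_gen i) = \<one>\<^bsub>Fn 2\<^esub>"
          by (simp only: retraction_free_gen if_False Fn_def one_free_group)
        with conj[OF i] show ?thesis by auto
      qed
    qed (use w F.group_axioms in \<open>simp_all add: Fn_def\<close>)
    then show ?thesis by simp
  qed
  have F2: "Fn 2 = free_group {1, 2}"
    unfolding Fn_def by (rule arg_cong[of _ _ free_group]) auto
  have surj: "carrier (Fn 2) \<subseteq> \<theta> ` carrier (Fn 2)"
  proof
    fix z assume z: "z \<in> carrier (Fn 2)"
    then have "z \<in> \<phi> ` carrier (Fn n)"
      using \<phi>b carrier_F2_subset by (auto simp: bij_betw_def)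
    then obtain w where w: "z = \<phi> w" "w \<in> carrier (Fn n)" by (rule imageE)
    have "z = ?r z" using z by (rule retraction_id[symmetric])
    also have "\<dots> = \<theta> (?r w)" using factor[OF w(2)] w(1) by simp
    finally show "z \<in> \<theta> ` carrier (Fn 2)" using w(2) by (intro image_eqI[of _ _ "?r w"]) auto
  qed
  have gens: "\<exists>f\<in>carrier (Fn 2). \<theta> (free_gen i) = inv\<^bsub>Fn 2\<^esub> f \<otimes>\<^bsub>Fn 2\<^esub> free_gen i \<otimes>\<^bsub>Fn 2\<^esub> f"
    if "i \<in> {1, 2}" for i
  proof -
    have "i \<in> {1..n}" "i \<in> {1..2}" using that n by auto
    with conj[of i] show ?thesis by (simp add: \<theta>gen \<tau>_def retraction_free_gen)
  qed
  obtain f where f: "f \<in> carrier (Fn 2)"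
    "\<theta> (free_gen 1) = inv\<^bsub>Fn 2\<^esub> f \<otimes>\<^bsub>Fn 2\<^esub> free_gen 1 \<otimes>\<^bsub>Fn 2\<^esub> f" using gens[of 1] by blast
  obtain g where g: "g \<in> carrier (Fn 2)"
    "\<theta> (free_gen 2) = inv\<^bsub>Fn 2\<^esub> g \<otimes>\<^bsub>Fn 2\<^esub> free_gen 2 \<otimes>\<^bsub>Fn 2\<^esub> g" using gens[of 2] by blast
  obtain c where c: "c \<in> carrier (Fn 2)"
    "\<And>w. w \<in> carrier (Fn 2) \<Longrightarrow> \<theta> w = inv\<^bsub>Fn 2\<^esub> c \<otimes>\<^bsub>Fn 2\<^esub> w \<otimes>\<^bsub>Fn 2\<^esub> c"
    using surj_conjugating_endo_inner[of 1 "2::nat" \<theta> f g] \<theta>h surj f g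
    unfolding F2[symmetric] by auto
  show ?thesis
    by (rule bexI[of _ "inv\<^bsub>Fn 2\<^esub> c"]) (use c in \<open>simp_all add: factor\<close>)
qed

text \<open>The quotient of two conjugators centralises \<open>F\<^sub>2\<close>. The uniqueness makes the choice of
  conjugators multiplicative.\<close>

lemma conjugator_unique:
  assumes c: "c \<in> carrier (Fn 2)" "d \<in> carrier (Fn 2)"
    and eq: "\<And>w. w \<in> carrier (Fn n) \<Longrightarrow>
      c \<otimes>\<^bsub>Fn 2\<^esub> retraction 2 w \<otimes>\<^bsub>Fn 2\<^esub> inv\<^bsub>Fn 2\<^esub> c =
      d \<otimes>\<^bsub>Fn 2\<^esub> retraction 2 w \<otimes>\<^bsub>Fn 2\<^esub> inv\<^bsub>Fn 2\<^esub> d"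
  shows "c = d"
proof -
  interpret F: group "Fn 2" by (rule group_Fn)
  let ?e = "inv\<^bsub>Fn 2\<^esub> d \<otimes>\<^bsub>Fn 2\<^esub> c"
  have comm: "?e \<otimes>\<^bsub>Fn 2\<^esub> w = w \<otimes>\<^bsub>Fn 2\<^esub> ?e" if w: "w \<in> carrier (Fn 2)" for w
  proof -
    have "retraction 2 w = w" using w by (rule retraction_id)
    then have e: "c \<otimes>\<^bsub>Fn 2\<^esub> w \<otimes>\<^bsub>Fn 2\<^esub> inv\<^bsub>Fn 2\<^esub> c = d \<otimes>\<^bsub>Fn 2\<^esub> w \<otimes>\<^bsub>Fn 2\<^esub> inv\<^bsub>Fn 2\<^esub> d"
      using eq[of w] w carrier_F2_subset by auto
    have "?e \<otimes>\<^bsub>Fn 2\<^esub> w = inv\<^bsub>Fn 2\<^esub> d \<otimes>\<^bsub>Fn 2\<^esub> (c \<otimes>\<^bsub>Fn 2\<^esub> w \<otimes>\<^bsub>Fn 2\<^esub> inv\<^bsub>Fn 2\<^esub> c) \<otimes>\<^bsub>Fn 2\<^esub> c"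
      using c w by (simp add: F.m_assoc)
    also have "\<dots> = (inv\<^bsub>Fn 2\<^esub> d \<otimes>\<^bsub>Fn 2\<^esub> d) \<otimes>\<^bsub>Fn 2\<^esub> w \<otimes>\<^bsub>Fn 2\<^esub> ?e"
      unfolding e using c w by (simp only: F.m_assoc F.m_closed F.inv_closed)
    finally show ?thesis using c w by simp
  qed
  have "?e \<in> carrier (Fn 2)" using c by simp
  then have "?e = []"
    using comm unfolding Fn_def
    by (intro commutes_with_two_generators[of 1 2 "{1..2}"]) auto
  then have "?e = \<one>\<^bsub>Fn 2\<^esub>" by (simp add: Fn_def one_free_group)
  moreover have "d \<otimes>\<^bsub>Fn 2\<^esub> ?e = c" using c by (simp add: F.m_assoc[symmetric])
  ultimately show ?thesis using c by simp
qed

text \<open>Writing the induced endomorphism as \<open>w \<mapsto> c w c\<^sup>-\<^sup>1\<close>, rather than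
  \<open>w \<mapsto> c\<^sup>-\<^sup>1 w c\<close>, makes \<open>\<phi> \<mapsto> c\<close> a homomorphism for composition of maps. The
  preimage of \<open>c\<close> is conjugation by \<open>c\<close>, viewed as an element of \<open>F\<^sub>n\<close>.\<close>

lemma Cb_onto_F2:
  "\<exists>h. group_hom (Cb n) (Fn 2) h \<and> h ` carrier (Cb n) = carrier (Fn 2)"
proof -
  interpret G: group "Fn n" by (rule group_Fn)
  interpret F: group "Fn 2" by (rule group_Fn)
  interpret C: group "Cb n" by (rule group_Cb)
  let ?r = "retraction 2"
  interpret r: group_hom "Fn n" "Fn 2" ?r
    by unfold_locales (rule retraction_hom)
  have "\<forall>\<phi>\<in>carrier (Cb n). \<exists>c. c \<in> carrier (Fn 2) \<and> (\<forall>w\<in>carrier (Fn n).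
      ?r (\<phi> w) = c \<otimes>\<^bsub>Fn 2\<^esub> ?r w \<otimes>\<^bsub>Fn 2\<^esub> inv\<^bsub>Fn 2\<^esub> c)"
    using retraction_Cb_inner by blast
  from bchoice[OF this] obtain \<kappa> where
    \<kappa>: "\<And>\<phi>. \<phi> \<in> carrier (Cb n) \<Longrightarrow> \<kappa> \<phi> \<in> carrier (Fn 2)"
      "\<And>\<phi> w. \<phi> \<in> carrier (Cb n) \<Longrightarrow> w \<in> carrier (Fn n) \<Longrightarrow>
        ?r (\<phi> w) = \<kappa> \<phi> \<otimes>\<^bsub>Fn 2\<^esub> ?r w \<otimes>\<^bsub>Fn 2\<^esub> inv\<^bsub>Fn 2\<^esub> (\<kappa> \<phi>)"
    by blast
  have Cb_closed: "\<phi> w \<in> carrier (Fn n)" if "\<phi> \<in> carrier (Cb n)" "w \<in> carrier (Fn n)" for \<phi> w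
    using that by (auto simp: carrier_Cb basis_conj_auto_def auto_def hom_def)
  have "\<kappa> \<in> hom (Cb n) (Fn 2)"
  proof (rule homI)
    fix \<phi> \<psi> assume \<phi>: "\<phi> \<in> carrier (Cb n)" and \<psi>: "\<psi> \<in> carrier (Cb n)"
    show "\<kappa> (\<phi> \<otimes>\<^bsub>Cb n\<^esub> \<psi>) = \<kappa> \<phi> \<otimes>\<^bsub>Fn 2\<^esub> \<kappa> \<psi>"
    proof (rule conjugator_unique)
      fix w assume w: "w \<in> carrier (Fn n)"
      have "\<kappa> (\<phi> \<otimes>\<^bsub>Cb n\<^esub> \<psi>) \<otimes>\<^bsub>Fn 2\<^esub> ?r w \<otimes>\<^bsub>Fn 2\<^esub> inv\<^bsub>Fn 2\<^esub> (\<kappa> (\<phi> \<otimes>\<^bsub>Cb n\<^esub> \<psi>)) = ?r (\<phi> (\<psi> w))"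
        using \<kappa>(2)[OF C.m_closed[OF \<phi> \<psi>] w] w by (simp add: mult_Cb[OF \<phi> \<psi>] compose_eq)
      also have "\<dots> = \<kappa> \<phi> \<otimes>\<^bsub>Fn 2\<^esub> (\<kappa> \<psi> \<otimes>\<^bsub>Fn 2\<^esub> ?r w \<otimes>\<^bsub>Fn 2\<^esub> inv\<^bsub>Fn 2\<^esub> (\<kappa> \<psi>))
          \<otimes>\<^bsub>Fn 2\<^esub> inv\<^bsub>Fn 2\<^esub> (\<kappa> \<phi>)"
        using \<kappa>(2)[OF \<phi> Cb_closed[OF \<psi> w]] \<kappa>(2)[OF \<psi> w] by simp
      also have "\<dots> = (\<kappa> \<phi> \<otimes>\<^bsub>Fn 2\<^esub> \<kappa> \<psi>) \<otimes>\<^bsub>Fn 2\<^esub> ?r w \<otimes>\<^bsub>Fn 2\<^esub> inv\<^bsub>Fn 2\<^esub> (\<kappa> \<phi> \<otimes>\<^bsub>Fn 2\<^esub> \<kappa> \<psi>)"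
        using \<kappa>(1)[OF \<phi>] \<kappa>(1)[OF \<psi>] r.hom_closed[OF w] by (simp add: F.m_assoc F.inv_mult_group)
      finally show "\<kappa> (\<phi> \<otimes>\<^bsub>Cb n\<^esub> \<psi>) \<otimes>\<^bsub>Fn 2\<^esub> ?r w \<otimes>\<^bsub>Fn 2\<^esub> inv\<^bsub>Fn 2\<^esub> (\<kappa> (\<phi> \<otimes>\<^bsub>Cb n\<^esub> \<psi>)) =
          (\<kappa> \<phi> \<otimes>\<^bsub>Fn 2\<^esub> \<kappa> \<psi>) \<otimes>\<^bsub>Fn 2\<^esub> ?r w \<otimes>\<^bsub>Fn 2\<^esub> inv\<^bsub>Fn 2\<^esub> (\<kappa> \<phi> \<otimes>\<^bsub>Fn 2\<^esub> \<kappa> \<psi>)" .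
    qed (use \<kappa>(1) \<phi> \<psi> C.m_closed in auto)
  qed (rule \<kappa>(1))
  then have hom: "group_hom (Cb n) (Fn 2) \<kappa>"
    by unfold_locales
  have "c \<in> \<kappa> ` carrier (Cb n)" if c: "c \<in> carrier (Fn 2)" for c
  proof -
    have cn: "c \<in> carrier (Fn n)" using c carrier_F2_subset by blast
    define \<phi> where "\<phi> = (\<lambda>w\<in>carrier (Fn n). c \<otimes>\<^bsub>Fn n\<^esub> w \<otimes>\<^bsub>Fn n\<^esub> inv\<^bsub>Fn n\<^esub> c)"
    interpret i: group_hom "Fn n" "Fn n" "\<lambda>w. c \<otimes>\<^bsub>Fn n\<^esub> w \<otimes>\<^bsub>Fn n\<^esub> inv\<^bsub>Fn n\<^esub> c"
      by (rule G.inner_hom[OF cn])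
    have "\<phi> \<in> hom (Fn n) (Fn n)"
      using i.homh by (simp add: hom_def \<phi>_def Pi_iff)
    moreover have "bij_betw \<phi> (carrier (Fn n)) (carrier (Fn n))"
    proof (rule bij_betw_byWitness[where f' = "\<lambda>w. inv\<^bsub>Fn n\<^esub> c \<otimes>\<^bsub>Fn n\<^esub> w \<otimes>\<^bsub>Fn n\<^esub> c"])
      have "inv\<^bsub>Fn n\<^esub> c \<otimes>\<^bsub>Fn n\<^esub> (c \<otimes>\<^bsub>Fn n\<^esub> w) = w" "c \<otimes>\<^bsub>Fn n\<^esub> (inv\<^bsub>Fn n\<^esub> c \<otimes>\<^bsub>Fn n\<^esub> w) = w"
        if "w \<in> carrier (Fn n)" for w
        using that cn by (simp_all add: G.m_assoc[symmetric])
      then show "\<forall>w\<in>carrier (Fn n). inv\<^bsub>Fn n\<^esub> c \<otimes>\<^bsub>Fn n\<^esub> \<phi> w \<otimes>\<^bsub>Fn n\<^esub> c = w"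
        "\<forall>w\<in>carrier (Fn n). \<phi> (inv\<^bsub>Fn n\<^esub> c \<otimes>\<^bsub>Fn n\<^esub> w \<otimes>\<^bsub>Fn n\<^esub> c) = w"
        using cn by (simp_all add: \<phi>_def G.m_assoc)
    qed (use cn in \<open>auto simp: \<phi>_def\<close>)
    ultimately have "\<phi> \<in> auto (Fn n)"
      by (simp add: auto_def Bij_def \<phi>_def)
    moreover have "\<exists>f\<in>carrier (Fn n). \<phi> (free_gen j) =
        inv\<^bsub>Fn n\<^esub> f \<otimes>\<^bsub>Fn n\<^esub> free_gen j \<otimes>\<^bsub>Fn n\<^esub> f" if "j \<in> {1..n}" for j
    proof (rule bexI[of _ "inv\<^bsub>Fn n\<^esub> c"])
      have "free_gen j \<in> carrier (Fn n)" using that by (simp add: Fn_def)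
      then show "\<phi> (free_gen j) =
          inv\<^bsub>Fn n\<^esub> (inv\<^bsub>Fn n\<^esub> c) \<otimes>\<^bsub>Fn n\<^esub> free_gen j \<otimes>\<^bsub>Fn n\<^esub> inv\<^bsub>Fn n\<^esub> c"
        using cn by (simp add: \<phi>_def)
    qed (use cn in simp)
    ultimately have \<phi>: "\<phi> \<in> carrier (Cb n)"
      by (simp add: carrier_Cb basis_conj_auto_def)
    have "?r c = c" using c by (rule retraction_id)
    have "\<kappa> \<phi> = c"
    proof (rule conjugator_unique[OF \<kappa>(1)[OF \<phi>] c])
      fix w assume w: "w \<in> carrier (Fn n)"
      have "?r (\<phi> w) = c \<otimes>\<^bsub>Fn 2\<^esub> ?r w \<otimes>\<^bsub>Fn 2\<^esub> inv\<^bsub>Fn 2\<^esub> c"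
        using w cn \<open>?r c = c\<close> by (simp add: \<phi>_def)
      then show "\<kappa> \<phi> \<otimes>\<^bsub>Fn 2\<^esub> ?r w \<otimes>\<^bsub>Fn 2\<^esub> inv\<^bsub>Fn 2\<^esub> (\<kappa> \<phi>) = c \<otimes>\<^bsub>Fn 2\<^esub> ?r w \<otimes>\<^bsub>Fn 2\<^esub> inv\<^bsub>Fn 2\<^esub> c"
        using \<kappa>(2)[OF \<phi> w] by simp
    qed
    with \<phi> show ?thesis by blast
  qed
  with \<kappa>(1) have "\<kappa> ` carrier (Cb n) = carrier (Fn 2)" by blast
  with hom show ?thesis by blast
qed

end

theorem proposition4p4:
  fixes n :: nat and V :: "'v word set"
  assumes "n \<ge> 2" and "finite V" and "proper_words V"
  shows "width (Cb n) V = \<infinity>"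
proof -
  obtain h where h: "group_hom (Cb n) (Fn 2) h" "h ` carrier (Cb n) = carrier (Fn 2)"
    using Cb_onto_F2[OF assms(1)] by blast
  have "width (Fn 2) V = \<infinity>"
    using width_free_group_infinite[of "1::nat" "{1..2}" 2 V] assms(2,3)
    by (simp add: proper_words_def Fn_def)
  then show ?thesis
    by (rule group_hom.width_infinite_if_image[OF h])
qed

end
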